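(* Let $A$ be a connected finite dimensional algebra over a field $k$ and let $(\mathcal{T},\mathcal{F})$ be a brick-splitting torsion pair in $\operatorname{mod} A$. Then for every simple module $S_1\in\mathcal{T}$ and every simple module $S_2\in\mathcal{F}$ we have $\operatorname{Ext}^1_A(S_2,S_1)=0$. Hence, in the Ext-quiver of $A$, there is no arrow from a vertex corresponding to a simple module in $\mathcal{F}$ to a vertex corresponding to a simple module in $\mathcal{T}$.
   Context: $\operatorname{mod} A$ is the category of finitely generated left $A$-modules. A brick is a module $X\in\operatorname{mod} A$ such that $\operatorname{End}_A(X)$ is a division algebra. A torsion pair $(\mathcal{T},\mathcal{F})$ in $\operatorname{mod} A$ is brick-splitting if every brick belongs to $\mathcal{T}$ or to $\mathcal{F}$. The Ext-quiver of $A$ has as vertices the isomorphism classes of simple modules, with a single arrow $S\to S'$ if and only if $\operatorname{Ext}^1_A(S,S')\neq 0$. *)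

theory Defs
  imports
    "HOL-Algebra.Module"
    "HOL-Algebra.Chinese_Remainder"
    "Graph_Theory.Digraph"
begin

no_notation dominates (\<open>_ \<rightarrow>\<index> _\<close> [100,100] 40)

section \<open>Algebras and left modules\<close>

text \<open>
  The locale \<^locale>\<open>module\<close> of the library requires a commutative ring of scalars;
  \<open>left_module\<close> has the same axioms over an arbitrary ring. The ring fields
  \<open>mult\<close> and \<open>one\<close> inherited by module records play no role.
\<close>

locale left_module = R?: ring R + M?: abelian_group M
  for R :: "('a, 'r) ring_scheme" and M :: "('a, 'm, 's) module_scheme" (structure) +
  assumes lsmult_closed:
      "\<lbrakk>a \<in> carrier R; x \<in> carrier M\<rbrakk> \<Longrightarrow> a \<odot> x \<in> carrier M"
    and lsmult_l_distr:
      "\<lbrakk>a \<in> carrier R; b \<in> carrier R; x \<in> carrier M\<rbrakk> \<Longrightarrow>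
        (a \<oplus>\<^bsub>R\<^esub> b) \<odot> x = a \<odot> x \<oplus> b \<odot> x"
    and lsmult_r_distr:
      "\<lbrakk>a \<in> carrier R; x \<in> carrier M; y \<in> carrier M\<rbrakk> \<Longrightarrow>
        a \<odot> (x \<oplus> y) = a \<odot> x \<oplus> a \<odot> y"
    and lsmult_assoc:
      "\<lbrakk>a \<in> carrier R; b \<in> carrier R; x \<in> carrier M\<rbrakk> \<Longrightarrow>
        (a \<otimes>\<^bsub>R\<^esub> b) \<odot> x = a \<odot> (b \<odot> x)"
    and lsmult_one:
      "x \<in> carrier M \<Longrightarrow> \<one>\<^bsub>R\<^esub> \<odot> x = x"

definition fin_gen :: "('a, 'r) ring_scheme \<Rightarrow> ('a, 'm, 's) module_scheme \<Rightarrow> bool" where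
  "fin_gen R M \<longleftrightarrow> (\<exists>G. finite G \<and> G \<subseteq> carrier M \<and>
     (\<forall>x\<in>carrier M. \<exists>c\<in>G \<rightarrow> carrier R. x = (\<Oplus>\<^bsub>M\<^esub>g\<in>G. c g \<odot>\<^bsub>M\<^esub> g)))"

locale k_algebra = K?: field k + A?: ring A + Module.module k A
  for k :: "('k, 'r) ring_scheme" and A :: "('k, 'a, 's) module_scheme" (structure) +
  assumes smult_mult_left:
      "\<lbrakk>c \<in> carrier k; a \<in> carrier A; b \<in> carrier A\<rbrakk> \<Longrightarrow> (c \<odot> a) \<otimes> b = c \<odot> (a \<otimes> b)"
    and smult_mult_right:
      "\<lbrakk>c \<in> carrier k; a \<in> carrier A; b \<in> carrier A\<rbrakk> \<Longrightarrow> a \<otimes> (c \<odot> b) = c \<odot> (a \<otimes> b)"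

definition fin_dim_algebra :: "('k, 'r) ring_scheme \<Rightarrow> ('k, 'a, 's) module_scheme \<Rightarrow> bool" where
  "fin_dim_algebra k A \<longleftrightarrow> k_algebra k A \<and> fin_gen k A"

text \<open>
  A factor of a direct product decomposition of \<open>A\<close> is isomorphic to a two-sided
  ideal of \<open>A\<close>, so it is enough to let the factors range over algebras
  whose elements have the same type as those of \<open>A\<close>.
\<close>

definition connected_algebra :: "('k, 'r) ring_scheme \<Rightarrow> ('k, 'a) module \<Rightarrow> bool" where
  "connected_algebra k A \<longleftrightarrow> k_algebra k A \<and> carrier A \<noteq> {\<zero>\<^bsub>A\<^esub>} \<and>
     \<not> (\<exists>(B :: ('k, 'a) module) (C :: ('k, 'a) module).
          k_algebra k B \<and> carrier B \<noteq> {\<zero>\<^bsub>B\<^esub>} \<and>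
          k_algebra k C \<and> carrier C \<noteq> {\<zero>\<^bsub>C\<^esub>} \<and>
          (\<exists>h\<in>ring_iso A (RDirProd B C).
             \<forall>c\<in>carrier k. \<forall>a\<in>carrier A.
               h (c \<odot>\<^bsub>A\<^esub> a) = (c \<odot>\<^bsub>B\<^esub> fst (h a), c \<odot>\<^bsub>C\<^esub> snd (h a))))"

definition division_algebra :: "('k, 'r) ring_scheme \<Rightarrow> ('k, 'a, 's) module_scheme \<Rightarrow> bool" where
  "division_algebra k D \<longleftrightarrow> k_algebra k D \<and> \<one>\<^bsub>D\<^esub> \<noteq> \<zero>\<^bsub>D\<^esub> \<and> Units D = carrier D - {\<zero>\<^bsub>D\<^esub>}"


section \<open>The category of finitely generated modules\<close>

text \<open>
  The objects are the finitely generated left modules whose elements are taken from a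
  fixed type \<open>'m\<close>. If \<open>'m\<close> is large enough, then up to isomorphism these
  are all finitely generated modules; see \<open>fin_gen_module_in_universe\<close> below.
\<close>

definition mod_cat :: "('a, 'r) ring_scheme \<Rightarrow> ('a, 'm) module set" where
  "mod_cat A = {M. left_module A M \<and> fin_gen A M}"

definition Hom :: "('a, 'r) ring_scheme \<Rightarrow> ('a, 'm) module \<Rightarrow> ('a, 'n) module \<Rightarrow> ('m \<Rightarrow> 'n) set" where
  "Hom A M N = {f \<in> carrier M \<rightarrow>\<^sub>E carrier N.
     (\<forall>x\<in>carrier M. \<forall>y\<in>carrier M. f (x \<oplus>\<^bsub>M\<^esub> y) = f x \<oplus>\<^bsub>N\<^esub> f y) \<and>
     (\<forall>a\<in>carrier A. \<forall>x\<in>carrier M. f (a \<odot>\<^bsub>M\<^esub> x) = a \<odot>\<^bsub>N\<^esub> f x)}"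

definition zero_hom :: "('a, 'm) module \<Rightarrow> ('a, 'n) module \<Rightarrow> 'm \<Rightarrow> 'n" where
  "zero_hom M N = (\<lambda>x\<in>carrier M. \<zero>\<^bsub>N\<^esub>)"

definition Iso :: "('a, 'r) ring_scheme \<Rightarrow> ('a, 'm) module \<Rightarrow> ('a, 'n) module \<Rightarrow> ('m \<Rightarrow> 'n) set" where
  "Iso A M N = {f \<in> Hom A M N. bij_betw f (carrier M) (carrier N)}"

definition iso_class :: "('a, 'r) ring_scheme \<Rightarrow> ('a, 'm) module \<Rightarrow> ('a, 'm) module set" where
  "iso_class A M = {N \<in> mod_cat A. Iso A M N \<noteq> {}}"

definition End_algebra :: "('k, 'a, 's) module_scheme \<Rightarrow> ('a, 'm) module \<Rightarrow> ('k, 'm \<Rightarrow> 'm) module" where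
  "End_algebra A M =
    \<lparr> carrier = Hom A M M,
      mult = (\<lambda>f g. \<lambda>x\<in>carrier M. f (g x)),
      one = (\<lambda>x\<in>carrier M. x),
      zero = zero_hom M M,
      add = (\<lambda>f g. \<lambda>x\<in>carrier M. f x \<oplus>\<^bsub>M\<^esub> g x),
      smult = (\<lambda>c f. \<lambda>x\<in>carrier M. (c \<odot>\<^bsub>A\<^esub> \<one>\<^bsub>A\<^esub>) \<odot>\<^bsub>M\<^esub> f x) \<rparr>"

definition brick :: "('k, 'r) ring_scheme \<Rightarrow> ('k, 'a, 's) module_scheme \<Rightarrow> ('a, 'm) module \<Rightarrow> bool" where
  "brick k A X \<longleftrightarrow> X \<in> mod_cat A \<and> division_algebra k (End_algebra A X)"

definition simple_module :: "('a, 'r) ring_scheme \<Rightarrow> ('a, 'm) module \<Rightarrow> bool" where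
  "simple_module A S \<longleftrightarrow> left_module A S \<and> carrier S \<noteq> {\<zero>\<^bsub>S\<^esub>} \<and>
     (\<forall>H. submodule H A S \<longrightarrow> H = {\<zero>\<^bsub>S\<^esub>} \<or> H = carrier S)"


section \<open>Torsion pairs\<close>

definition torsion_pair ::
    "('a, 'r) ring_scheme \<Rightarrow> ('a, 'm) module set \<Rightarrow> ('a, 'm) module set \<Rightarrow> bool" where
  "torsion_pair A T F \<longleftrightarrow>
     T = {M \<in> mod_cat A. \<forall>N\<in>F. Hom A M N = {zero_hom M N}} \<and>
     F = {N \<in> mod_cat A. \<forall>M\<in>T. Hom A M N = {zero_hom M N}}"

definition brick_splitting ::
    "('k, 'r) ring_scheme \<Rightarrow> ('k, 'a, 's) module_scheme \<Rightarrow>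
     ('a, 'm) module set \<Rightarrow> ('a, 'm) module set \<Rightarrow> bool" where
  "brick_splitting k A T F \<longleftrightarrow> torsion_pair A T F \<and> (\<forall>X. brick k A X \<longrightarrow> X \<in> T \<or> X \<in> F)"


section \<open>First extension groups and the Ext-quiver\<close>

text \<open>
  \<open>Ext1 A M N\<close> is the Yoneda extension group: the short exact sequences
  \<open>0 \<rightarrow> N \<rightarrow> E \<rightarrow> M \<rightarrow> 0\<close> up to equivalence. Its zero element is the class of the
  sequences that split. Only the zero element is needed here, so the Baer sum is not defined.
\<close>

type_synonym ('a, 'm) extension = "('a, 'm) module \<times> ('m \<Rightarrow> 'm) \<times> ('m \<Rightarrow> 'm)"

definition extensions ::
    "('a, 'r) ring_scheme \<Rightarrow> ('a, 'm) module \<Rightarrow> ('a, 'm) module \<Rightarrow> ('a, 'm) extension set" where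
  "extensions A M N = {(E, i, p). E \<in> mod_cat A \<and> i \<in> Hom A N E \<and> p \<in> Hom A E M \<and>
     inj_on i (carrier N) \<and>
     i ` carrier N = {x \<in> carrier E. p x = \<zero>\<^bsub>M\<^esub>} \<and>
     p ` carrier E = carrier M}"

definition extension_equiv ::
    "('a, 'r) ring_scheme \<Rightarrow> ('a, 'm) module \<Rightarrow> ('a, 'm) module \<Rightarrow> ('a, 'm) extension rel" where
  "extension_equiv A M N = {((E, i, p), (E', i', p')).
     (E, i, p) \<in> extensions A M N \<and> (E', i', p') \<in> extensions A M N \<and>
     (\<exists>h\<in>Iso A E E'. (\<forall>x\<in>carrier N. h (i x) = i' x) \<and> (\<forall>x\<in>carrier E. p' (h x) = p x))}"

definition Ext1 ::
    "('a, 'r) ring_scheme \<Rightarrow> ('a, 'm) module \<Rightarrow> ('a, 'm) module \<Rightarrow> ('a, 'm) extension set set" where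
  "Ext1 A M N = extensions A M N // extension_equiv A M N"

definition Ext1_zero ::
    "('a, 'r) ring_scheme \<Rightarrow> ('a, 'm) module \<Rightarrow> ('a, 'm) module \<Rightarrow> ('a, 'm) extension set" where
  "Ext1_zero A M N = {(E, i, p) \<in> extensions A M N.
     \<exists>s\<in>Hom A M E. \<forall>x\<in>carrier M. p (s x) = x}"

text \<open>
  An arrow is the pair of its end points, so there is at most one arrow from a vertex
  to another.
\<close>

definition ext_quiver ::
    "('a, 'r) ring_scheme \<Rightarrow>
     (('a, 'm) module set, ('a, 'm) module set \<times> ('a, 'm) module set) pre_digraph" where
  "ext_quiver A = (let V = {iso_class A S | S. S \<in> mod_cat A \<and> simple_module A S} in
    \<lparr> verts = V,
      arcs = {(v, w) \<in> V \<times> V. \<exists>S\<in>v. \<exists>S'\<in>w. Ext1 A S S' \<noteq> {Ext1_zero A S S'}},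
      tail = fst,
      head = snd \<rparr>)"


section \<open>Basic facts\<close>

context left_module begin

lemma lsmult_r_zero: "a \<in> carrier R \<Longrightarrow> a \<odot> \<zero> = \<zero>"
  using lsmult_r_distr[of a \<zero> \<zero>] lsmult_closed[of a \<zero>] M.add.l_cancel_one'[of "a \<odot> \<zero>" "a \<odot> \<zero>"] by simp

lemma lsmult_l_zero: "x \<in> carrier M \<Longrightarrow> \<zero>\<^bsub>R\<^esub> \<odot> x = \<zero>"
  using lsmult_l_distr[of "\<zero>\<^bsub>R\<^esub>" "\<zero>\<^bsub>R\<^esub>" x] lsmult_closed[of "\<zero>\<^bsub>R\<^esub>" x]
    M.add.l_cancel_one'[of "\<zero>\<^bsub>R\<^esub> \<odot> x" "\<zero>\<^bsub>R\<^esub> \<odot> x"] by simp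

end

lemma HomD:
  assumes "f \<in> Hom A M N"
  shows "x \<in> carrier M \<Longrightarrow> f x \<in> carrier N"
    and "\<lbrakk>x \<in> carrier M; y \<in> carrier M\<rbrakk> \<Longrightarrow> f (x \<oplus>\<^bsub>M\<^esub> y) = f x \<oplus>\<^bsub>N\<^esub> f y"
    and "\<lbrakk>a \<in> carrier A; x \<in> carrier M\<rbrakk> \<Longrightarrow> f (a \<odot>\<^bsub>M\<^esub> x) = a \<odot>\<^bsub>N\<^esub> f x"
  using assms by (auto simp: Hom_def)

lemma Hom_zero:
  assumes "left_module A M" "left_module A N" "f \<in> Hom A M N"
  shows "f \<zero>\<^bsub>M\<^esub> = \<zero>\<^bsub>N\<^esub>"
proof -
  interpret M: left_module A M by fact
  interpret N: left_module A N by fact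
  show ?thesis
  proof -
    have "f \<zero>\<^bsub>M\<^esub> \<in> carrier N" using HomD(1)[OF assms(3)] by simp
    moreover have "f \<zero>\<^bsub>M\<^esub> = f \<zero>\<^bsub>M\<^esub> \<oplus>\<^bsub>N\<^esub> f \<zero>\<^bsub>M\<^esub>"
      using HomD(2)[OF assms(3), of "\<zero>\<^bsub>M\<^esub>" "\<zero>\<^bsub>M\<^esub>"] by simp
    ultimately show ?thesis using N.M.add.l_cancel_one' by blast
  qed
qed

lemma Hom_finsum:
  assumes "left_module A M" "left_module A N" "f \<in> Hom A M N"
    and "finite G" "c \<in> G \<rightarrow> carrier A" "v \<in> G \<rightarrow> carrier M"
  shows "f (\<Oplus>\<^bsub>M\<^esub>g\<in>G. c g \<odot>\<^bsub>M\<^esub> v g) = (\<Oplus>\<^bsub>N\<^esub>g\<in>G. c g \<odot>\<^bsub>N\<^esub> f (v g))"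
proof -
  interpret M: left_module A M by fact
  interpret N: left_module A N by fact
  show ?thesis using assms(4-6)
  proof (induction G rule: finite_induct)
    case empty
    then show ?case using Hom_zero[OF assms(1-3)] by simp
  next
    case (insert g G)
    have 1: "(\<lambda>g. c g \<odot>\<^bsub>M\<^esub> v g) \<in> G \<rightarrow> carrier M" "(\<lambda>g. c g \<odot>\<^bsub>N\<^esub> f (v g)) \<in> G \<rightarrow> carrier N"
      using insert.prems by (auto intro!: M.lsmult_closed N.lsmult_closed HomD(1)[OF assms(3)])
    have "c g \<odot>\<^bsub>M\<^esub> v g \<in> carrier M" "c g \<odot>\<^bsub>N\<^esub> f (v g) \<in> carrier N"
      using insert.prems by (auto intro!: M.lsmult_closed N.lsmult_closed HomD(1)[OF assms(3)])
    then show ?case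
      using insert.hyps insert.IH insert.prems 1 HomD(2)[OF assms(3)] HomD(3)[OF assms(3)] M.M.finsum_closed[OF 1(1)]
      by (simp add: Pi_iff)
  qed
qed

lemma fin_gen_Iso:
  assumes "left_module A M" "left_module A N" "f \<in> Iso A M N" "fin_gen A M"
  shows "fin_gen A N"
proof -
  interpret M: left_module A M by fact
  interpret N: left_module A N by fact
  have f: "f \<in> Hom A M N" and bij: "bij_betw f (carrier M) (carrier N)"
    using assms by (auto simp: Iso_def)
  obtain G where G: "finite G" "G \<subseteq> carrier M"
    "\<And>x. x \<in> carrier M \<Longrightarrow> \<exists>c\<in>G \<rightarrow> carrier A. x = (\<Oplus>\<^bsub>M\<^esub>g\<in>G. c g \<odot>\<^bsub>M\<^esub> g)"
    using assms(4) by (auto simp: fin_gen_def)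
  have inj: "inj_on f G" using bij G(2) by (auto simp: bij_betw_def inj_on_subset)
  show ?thesis unfolding fin_gen_def
  proof (intro exI[of _ "f ` G"] conjI ballI)
    fix y assume "y \<in> carrier N"
    then obtain x where x: "x \<in> carrier M" "y = f x" using bij by (auto simp: bij_betw_def)
    obtain c where c: "c \<in> G \<rightarrow> carrier A" "x = (\<Oplus>\<^bsub>M\<^esub>g\<in>G. c g \<odot>\<^bsub>M\<^esub> g)" using G(3) x by blast
    let ?d = "\<lambda>h. c (inv_into G f h)"
    have d: "?d (f g) = c g" if "g \<in> G" for g using inj that by simp
    have dA: "?d \<in> f ` G \<rightarrow> carrier A" using c d by auto
    have "y = (\<Oplus>\<^bsub>N\<^esub>g\<in>G. c g \<odot>\<^bsub>N\<^esub> f g)"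
      using Hom_finsum[OF assms(1,2) f G(1) c(1), of "\<lambda>g. g"] G(2) x c by auto
    also have "\<dots> = (\<Oplus>\<^bsub>N\<^esub>g\<in>G. ?d (f g) \<odot>\<^bsub>N\<^esub> f g)"
      by (rule N.M.finsum_cong') (use c d G(2) f in \<open>auto intro!: N.lsmult_closed HomD(1)[OF f]\<close>)
    also have "\<dots> = (\<Oplus>\<^bsub>N\<^esub>h\<in>f ` G. ?d h \<odot>\<^bsub>N\<^esub> h)"
      by (rule N.M.finsum_reindex[symmetric])
        (use dA inj G(2) in \<open>auto intro!: N.lsmult_closed HomD(1)[OF f]\<close>)
    finally show "\<exists>c\<in>f ` G \<rightarrow> carrier A. y = (\<Oplus>\<^bsub>N\<^esub>h\<in>f ` G. c h \<odot>\<^bsub>N\<^esub> h)"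
      using dA by (intro bexI[of _ ?d])
  qed (use G HomD(1)[OF f] in auto)
qed

definition image_module :: "('m \<Rightarrow> 'n) \<Rightarrow> ('a, 'm) module \<Rightarrow> ('a, 'n) module" where
  "image_module j M = (let r = inv_into (carrier M) j in
    \<lparr> carrier = j ` carrier M, mult = undefined, one = undefined,
      zero = j \<zero>\<^bsub>M\<^esub>,
      add = (\<lambda>x y. j (r x \<oplus>\<^bsub>M\<^esub> r y)),
      smult = (\<lambda>a x. j (a \<odot>\<^bsub>M\<^esub> r x)) \<rparr>)"

lemma image_module:
  assumes "left_module A M" "inj_on j (carrier M)"
  shows "left_module A (image_module j M)"
    and "restrict j (carrier M) \<in> Iso A M (image_module j M)"
proof -
  interpret M: left_module A M by fact
  have inv: "inv_into (carrier M) j (j x) = x" if "x \<in> carrier M" for x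
    using assms(2) that by simp
  note image_module_def [simp] Let_def [simp]
  have "abelian_group (image_module j M)"
  proof (rule abelian_groupI)
    fix x assume "x \<in> carrier (image_module j M)"
    then obtain u where u: "u \<in> carrier M" "x = j u" by auto
    show "\<exists>y\<in>carrier (image_module j M). y \<oplus>\<^bsub>image_module j M\<^esub> x = \<zero>\<^bsub>image_module j M\<^esub>"
      by (rule bexI[of _ "j (\<ominus>\<^bsub>M\<^esub> u)"]) (auto simp: inv u M.M.l_neg)
  qed (auto simp: inv M.M.a_ac)
  then show "left_module A (image_module j M)"
    by (intro left_module.intro left_module_axioms.intro M.ring_axioms)
      (auto simp: inv M.lsmult_closed M.lsmult_l_distr M.lsmult_r_distr M.lsmult_assoc M.lsmult_one)
  show "restrict j (carrier M) \<in> Iso A M (image_module j M)"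
    using assms(2) by (auto simp: Iso_def Hom_def inv M.lsmult_closed bij_betw_def inj_on_def)
qed

lemma fin_gen_embeds_in_lists:
  fixes A :: "('k, 'a, 's) module_scheme" and M :: "('a, 'm) module"
  assumes "fin_dim_algebra k A" "left_module A M" "fin_gen A M"
  obtains e :: "'m \<Rightarrow> 'k list"
  where "inj_on e (carrier M)" "e ` carrier M \<subseteq> lists (carrier k)"
proof -
  interpret M: left_module A M by fact
  obtain B where B: "finite B" "B \<subseteq> carrier A"
    "\<And>a. a \<in> carrier A \<Longrightarrow> \<exists>d\<in>B \<rightarrow> carrier k. a = (\<Oplus>\<^bsub>A\<^esub>b\<in>B. d b \<odot>\<^bsub>A\<^esub> b)"
    using assms(1) by (auto simp: fin_dim_algebra_def fin_gen_def)
  obtain G where G: "finite G" "G \<subseteq> carrier M"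
    "\<And>x. x \<in> carrier M \<Longrightarrow> \<exists>c\<in>G \<rightarrow> carrier A. x = (\<Oplus>\<^bsub>M\<^esub>g\<in>G. c g \<odot>\<^bsub>M\<^esub> g)"
    using assms(3) by (auto simp: fin_gen_def)
  have "\<forall>a\<in>carrier A. \<exists>d. d \<in> B \<rightarrow> carrier k \<and> a = (\<Oplus>\<^bsub>A\<^esub>b\<in>B. d b \<odot>\<^bsub>A\<^esub> b)"
    using B(3) by (auto simp: Bex_def)
  from bchoice[OF this] obtain d where d: "\<And>a. a \<in> carrier A \<Longrightarrow> d a \<in> B \<rightarrow> carrier k"
    "\<And>a. a \<in> carrier A \<Longrightarrow> a = (\<Oplus>\<^bsub>A\<^esub>b\<in>B. d a b \<odot>\<^bsub>A\<^esub> b)"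
    by auto
  have "\<forall>x\<in>carrier M. \<exists>c. c \<in> G \<rightarrow> carrier A \<and> x = (\<Oplus>\<^bsub>M\<^esub>g\<in>G. c g \<odot>\<^bsub>M\<^esub> g)"
    using G(3) by (auto simp: Bex_def)
  from bchoice[OF this] obtain c where c: "\<And>x. x \<in> carrier M \<Longrightarrow> c x \<in> G \<rightarrow> carrier A"
    "\<And>x. x \<in> carrier M \<Longrightarrow> x = (\<Oplus>\<^bsub>M\<^esub>g\<in>G. c x g \<odot>\<^bsub>M\<^esub> g)"
    by auto
  obtain bs where bs: "set bs = B" using B(1) finite_list by blast
  obtain gs where gs: "set gs = G" using G(1) finite_list by blast
  define e where "e x = map (\<lambda>(g, b). d (c x g) b) (List.product gs bs)" for x
  interpret k: k_algebra k A using assms(1) by (simp add: fin_dim_algebra_def)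
  have A: "abelian_monoid A"
    using k_algebra.axioms(2)[OF k.k_algebra_axioms] by (rule abelian_group.axioms(1)[OF ring.is_abelian_group])
  show thesis
  proof (rule that[of e])
    show "inj_on e (carrier M)"
    proof (rule inj_onI)
      fix x y assume xy: "x \<in> carrier M" "y \<in> carrier M" "e x = e y"
      have 1: "d (c x g) b = d (c y g) b" if "g \<in> G" "b \<in> B" for g b
        using xy(3) that bs gs by (auto simp: e_def)
      have 2: "c x g = c y g" if g: "g \<in> G" for g
      proof -
        have cA: "c x g \<in> carrier A" "c y g \<in> carrier A" using c(1) xy g by auto
        have "c x g = (\<Oplus>\<^bsub>A\<^esub>b\<in>B. d (c x g) b \<odot>\<^bsub>A\<^esub> b)" using d(2) cA by auto
        also have "\<dots> = (\<Oplus>\<^bsub>A\<^esub>b\<in>B. d (c y g) b \<odot>\<^bsub>A\<^esub> b)"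
          by (rule abelian_monoid.finsum_cong'[OF A]) (use 1 g d(1)[OF cA(2)] B(2) in \<open>auto intro!: k.smult_closed\<close>)
        also have "\<dots> = c y g" using d(2) cA by auto
        finally show ?thesis .
      qed
      have "x = (\<Oplus>\<^bsub>M\<^esub>g\<in>G. c x g \<odot>\<^bsub>M\<^esub> g)" using c xy by auto
      also have "\<dots> = (\<Oplus>\<^bsub>M\<^esub>g\<in>G. c y g \<odot>\<^bsub>M\<^esub> g)"
        by (rule M.M.finsum_cong') (use 2 c(1)[OF xy(2)] G(2) in \<open>auto intro!: M.lsmult_closed\<close>)
      also have "\<dots> = y" using c xy by auto
      finally show "x = y" .
    qed
    show "e ` carrier M \<subseteq> lists (carrier k)"
    proof -
      have "d (c x g) b \<in> carrier k" if "x \<in> carrier M" "g \<in> G" "b \<in> B" for x g b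
        using that c(1)[of x] d(1)[of "c x g"] by (auto simp: Pi_iff)
      then show ?thesis by (auto simp: e_def in_lists_conv_set bs gs)
    qed
  qed
qed

text \<open>
  If \<open>'m\<close> has room for all finite lists over \<open>k\<close>, every finitely
  generated module over a finite dimensional \<open>k\<close>-algebra, of whatever element type, is
  isomorphic to an object of \<^const>\<open>mod_cat\<close> over \<open>'m\<close>.
\<close>

lemma fin_gen_module_in_universe:
  fixes A :: "('k, 'a, 's) module_scheme" and \<iota> :: "'k list \<Rightarrow> 'm" and M :: "('a, 'n) module"
  assumes "fin_dim_algebra k A" "inj_on \<iota> (lists (carrier k))" "M \<in> mod_cat A"
  obtains N :: "('a, 'm) module" and h where "N \<in> mod_cat A" "h \<in> Iso A M N"
proof -
  have M: "left_module A M" "fin_gen A M" using assms(3) by (auto simp: mod_cat_def)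
  obtain e :: "'n \<Rightarrow> 'k list"
    where e: "inj_on e (carrier M)" "e ` carrier M \<subseteq> lists (carrier k)"
    using fin_gen_embeds_in_lists[OF assms(1) M] .
  have j: "inj_on (\<iota> \<circ> e) (carrier M)"
    using e assms(2) by (meson comp_inj_on inj_on_subset)
  show thesis
    using that[of "image_module (\<iota> \<circ> e) M"] image_module[OF M(1) j] fin_gen_Iso M(1,2)
    unfolding mod_cat_def by blast
qed

lemma Hom_ext:
  assumes "f \<in> Hom A M N" "g \<in> Hom A M N" "\<And>x. x \<in> carrier M \<Longrightarrow> f x = g x"
  shows "f = g"
  using assms by (auto simp: Hom_def intro: PiE_ext)

lemma k_algebra_End_algebra:
  assumes "k_algebra k A" "left_module A M"
  shows "k_algebra k (End_algebra A M)"
proof -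
  interpret k_algebra k A by fact
  interpret M: left_module A M by fact
  let ?E = "End_algebra A M"
  have cen: "a \<otimes>\<^bsub>A\<^esub> (c \<odot>\<^bsub>A\<^esub> \<one>\<^bsub>A\<^esub>) = (c \<odot>\<^bsub>A\<^esub> \<one>\<^bsub>A\<^esub>) \<otimes>\<^bsub>A\<^esub> a" if "c \<in> carrier k" "a \<in> carrier A" for a c
    using that by (simp add: smult_mult_left smult_mult_right)
  have swap: "a \<odot>\<^bsub>M\<^esub> ((c \<odot>\<^bsub>A\<^esub> \<one>\<^bsub>A\<^esub>) \<odot>\<^bsub>M\<^esub> x) = (c \<odot>\<^bsub>A\<^esub> \<one>\<^bsub>A\<^esub>) \<odot>\<^bsub>M\<^esub> (a \<odot>\<^bsub>M\<^esub> x)"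
    if "c \<in> carrier k" "a \<in> carrier A" "x \<in> carrier M" for a c x
    using that cen[of c a] M.lsmult_assoc[of a "c \<odot>\<^bsub>A\<^esub> \<one>\<^bsub>A\<^esub>" x] M.lsmult_assoc[of "c \<odot>\<^bsub>A\<^esub> \<one>\<^bsub>A\<^esub>" a x] by simp
  have scal: "(c \<odot>\<^bsub>A\<^esub> \<one>\<^bsub>A\<^esub>) \<in> carrier A" if "c \<in> carrier k" for c using that by simp
  have car: "carrier ?E = Hom A M M" by (simp add: End_algebra_def)
  have mult: "f \<otimes>\<^bsub>?E\<^esub> g \<in> Hom A M M" if "f \<in> Hom A M M" "g \<in> Hom A M M" for f g
    by (auto simp: End_algebra_def Hom_def[of A M M] M.lsmult_closed HomD[OF that(1)] HomD[OF that(2)])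
  have add: "f \<oplus>\<^bsub>?E\<^esub> g \<in> Hom A M M" if "f \<in> Hom A M M" "g \<in> Hom A M M" for f g
    by (auto simp: End_algebra_def Hom_def[of A M M] M.lsmult_closed M.lsmult_r_distr M.M.a_ac
        HomD[OF that(1)] HomD[OF that(2)])
  have one: "\<one>\<^bsub>?E\<^esub> \<in> Hom A M M"
    by (auto simp: End_algebra_def Hom_def M.lsmult_closed)
  have zero: "\<zero>\<^bsub>?E\<^esub> \<in> Hom A M M"
    by (auto simp: End_algebra_def Hom_def zero_hom_def M.lsmult_closed M.lsmult_r_zero)
  have smult: "c \<odot>\<^bsub>?E\<^esub> f \<in> Hom A M M" if "c \<in> carrier k" "f \<in> Hom A M M" for c f
    using that(1) by (auto simp: End_algebra_def Hom_def[of A M M] M.lsmult_closed M.lsmult_r_distr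
        swap HomD[OF that(2)])
  have app: "(f \<otimes>\<^bsub>?E\<^esub> g) x = f (g x)" "(f \<oplus>\<^bsub>?E\<^esub> g) x = f x \<oplus>\<^bsub>M\<^esub> g x" "\<one>\<^bsub>?E\<^esub> x = x"
     "\<zero>\<^bsub>?E\<^esub> x = \<zero>\<^bsub>M\<^esub>" "(c \<odot>\<^bsub>?E\<^esub> f) x = (c \<odot>\<^bsub>A\<^esub> \<one>\<^bsub>A\<^esub>) \<odot>\<^bsub>M\<^esub> f x" if "x \<in> carrier M" for f g x c
    using that by (auto simp: End_algebra_def zero_hom_def)
  note closed = mult add one zero smult
  have neg: "\<exists>g\<in>Hom A M M. g \<oplus>\<^bsub>?E\<^esub> f = \<zero>\<^bsub>?E\<^esub>" if f: "f \<in> Hom A M M" for f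
  proof (rule bexI[of _ "(\<ominus>\<^bsub>k\<^esub> \<one>\<^bsub>k\<^esub>) \<odot>\<^bsub>?E\<^esub> f"])
    show g: "(\<ominus>\<^bsub>k\<^esub> \<one>\<^bsub>k\<^esub>) \<odot>\<^bsub>?E\<^esub> f \<in> Hom A M M" using f by (intro smult) auto
    have 1: "((\<ominus>\<^bsub>k\<^esub> \<one>\<^bsub>k\<^esub>) \<odot>\<^bsub>A\<^esub> \<one>\<^bsub>A\<^esub>) \<oplus>\<^bsub>A\<^esub> \<one>\<^bsub>A\<^esub> = \<zero>\<^bsub>A\<^esub>"
      by (simp add: smult_l_minus A.l_neg)
    have "((\<ominus>\<^bsub>k\<^esub> \<one>\<^bsub>k\<^esub>) \<odot>\<^bsub>A\<^esub> \<one>\<^bsub>A\<^esub>) \<odot>\<^bsub>M\<^esub> y \<oplus>\<^bsub>M\<^esub> y = \<zero>\<^bsub>M\<^esub>" if "y \<in> carrier M" for y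
      using M.lsmult_l_distr[of "(\<ominus>\<^bsub>k\<^esub> \<one>\<^bsub>k\<^esub>) \<odot>\<^bsub>A\<^esub> \<one>\<^bsub>A\<^esub>" "\<one>\<^bsub>A\<^esub>" y] that 1 M.lsmult_l_zero M.lsmult_one by simp
    then show "((\<ominus>\<^bsub>k\<^esub> \<one>\<^bsub>k\<^esub>) \<odot>\<^bsub>?E\<^esub> f) \<oplus>\<^bsub>?E\<^esub> f = \<zero>\<^bsub>?E\<^esub>"
      by (intro Hom_ext[of _ A M M] closed g f) (simp add: app HomD(1)[OF f])
  qed
  have ab: "abelian_group ?E"
    by (rule abelian_groupI; (unfold car)?)
      (use closed neg in \<open>auto intro!: Hom_ext[of _ A M M] simp: app HomD(1) M.M.a_ac\<close>)
  have rng: "ring ?E"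
  proof (rule ringI)
    show "monoid ?E"
      by (rule monoidI; unfold car)
        (auto intro!: Hom_ext[of _ A M M] closed simp: app HomD(1))
  qed (unfold car, use ab in \<open>auto intro!: Hom_ext[of _ A M M] closed simp: app HomD\<close>)
  have mod: "Module.module k ?E"
  proof (rule moduleI)
    show "cring k" by (rule K.is_cring)
  qed (unfold car, use ab in \<open>auto intro!: Hom_ext[of _ A M M] closed
     simp: app HomD M.lsmult_r_distr smult_l_distr M.lsmult_l_distr M.lsmult_assoc[symmetric] smult_mult_left smult_assoc1 M.lsmult_one\<close>)
  show ?thesis
    by (intro k_algebra.intro k_algebra_axioms.intro rng mod K.field_axioms; (unfold car)?)
      (auto intro!: Hom_ext[of _ A M M] closed simp: app HomD)
qed

end

theory Submission
  imports Defs
begin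

text \<open>
  In a non-split extension \<open>0 \<rightarrow> S\<^sub>1 \<rightarrow> E \<rightarrow> S\<^sub>2 \<rightarrow> 0\<close> of simple modules the only
  submodules of \<open>E\<close> are \<open>0\<close>, \<open>S\<^sub>1\<close> and \<open>E\<close>. If moreover \<open>Hom(S\<^sub>1, S\<^sub>2) = 0\<close>, then
  this forces every non-zero endomorphism of \<open>E\<close> to be bijective, so \<open>E\<close> is a brick.
  But \<open>E\<close> cannot be torsion, because it maps onto \<open>S\<^sub>2 \<in> F\<close>, and it cannot be
  torsion-free, because it contains \<open>S\<^sub>1 \<in> T\<close>.
\<close>

section \<open>Submodules and homomorphisms\<close>

text \<open>Kernel and image of a non-zero endomorphism \<open>f\<close> of \<open>E\<close> are
  among the three submodules, so the work is to exclude \<open>S1\<close> as kernel and as image.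
  \<open>Hom(S1, S2) = 0\<close> enters twice: it makes \<open>S1\<close> stable under
  \<open>f\<close>, and it rules out the isomorphism \<open>S1 \<cong> S2\<close> that an
  \<open>f\<close> with both kernel and image \<open>S1\<close> would produce. Two further obstacles
  come from the encoding. \<open>Ext1\<close> is a set of equivalence classes, so its vanishing says
  that the quotient is the singleton \<open>{Ext1_zero}\<close>: besides every extension being
  split, the split ones must form a single class, and one must exist. The obvious candidate, the
  direct sum, consists of pairs and has to be copied into the element type \<open>'m\<close> by
  means of \<open>\<iota>\<close>. Moreover, an arrow of the quiver is witnessed by arbitrary
  representatives of two isomorphism classes, so simplicity and membership in \<open>T\<close> or
  \<open>F\<close> must be carried along isomorphisms.\<close>

lemma (in left_module) lsmult_minus_one:
  assumes "x \<in> carrier M"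
  shows "(\<ominus>\<^bsub>R\<^esub> \<one>\<^bsub>R\<^esub>) \<odot> x = \<ominus> x"
proof -
  have "(\<ominus>\<^bsub>R\<^esub> \<one>\<^bsub>R\<^esub>) \<odot> x \<oplus> x = \<zero>"
    using lsmult_l_distr[of "\<ominus>\<^bsub>R\<^esub> \<one>\<^bsub>R\<^esub>" "\<one>\<^bsub>R\<^esub>" x] assms
    by (simp add: lsmult_one lsmult_l_zero R.l_neg)
  then show ?thesis
    using assms M.minus_equality[of "(\<ominus>\<^bsub>R\<^esub> \<one>\<^bsub>R\<^esub>) \<odot> x" x] by (simp add: lsmult_closed)
qed

text \<open>Negation is the action of the scalar -1, so closure under sums and scalars already
  yields an additive subgroup.\<close>

lemma (in left_module) left_submoduleI:
  assumes "H \<subseteq> carrier M" "\<zero> \<in> H"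
    and "\<And>x y. \<lbrakk>x \<in> H; y \<in> H\<rbrakk> \<Longrightarrow> x \<oplus> y \<in> H"
    and smult: "\<And>a x. \<lbrakk>a \<in> carrier R; x \<in> H\<rbrakk> \<Longrightarrow> a \<odot> x \<in> H"
  shows "submodule H R M"
proof (intro submodule.intro subgroup.intro submodule_axioms.intro)
  fix x assume x: "x \<in> H"
  have "\<ominus> x = (\<ominus>\<^bsub>R\<^esub> \<one>\<^bsub>R\<^esub>) \<odot> x"
    using lsmult_minus_one[of x] assms(1) x by auto
  then show "inv\<^bsub>add_monoid M\<^esub> x \<in> H"
    using smult[OF _ x] by (simp add: a_inv_def)
qed (use assms in auto)

lemma (in left_module) minus_eq_zero_iff:
  assumes "x \<in> carrier M" "y \<in> carrier M"
  shows "x \<ominus> y = \<zero> \<longleftrightarrow> x = y"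
  using assms M.minus_equality[of x "\<ominus> y"] by (auto simp: a_minus_def M.r_neg)

lemma submoduleD:
  assumes "submodule H A M"
  shows "x \<in> H \<Longrightarrow> x \<in> carrier M"
    and "\<zero>\<^bsub>M\<^esub> \<in> H"
    and "\<lbrakk>x \<in> H; y \<in> H\<rbrakk> \<Longrightarrow> x \<oplus>\<^bsub>M\<^esub> y \<in> H"
    and "x \<in> H \<Longrightarrow> \<ominus>\<^bsub>M\<^esub> x \<in> H"
    and "\<lbrakk>a \<in> carrier A; x \<in> H\<rbrakk> \<Longrightarrow> a \<odot>\<^bsub>M\<^esub> x \<in> H"
proof -
  interpret submodule H A M by fact
  show "x \<in> H \<Longrightarrow> x \<in> carrier M" using subset by auto
  show "\<zero>\<^bsub>M\<^esub> \<in> H" using one_closed by simp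
  show "\<lbrakk>x \<in> H; y \<in> H\<rbrakk> \<Longrightarrow> x \<oplus>\<^bsub>M\<^esub> y \<in> H" using m_closed by simp
  show "x \<in> H \<Longrightarrow> \<ominus>\<^bsub>M\<^esub> x \<in> H" using m_inv_closed by (simp add: a_inv_def)
  show "\<lbrakk>a \<in> carrier A; x \<in> H\<rbrakk> \<Longrightarrow> a \<odot>\<^bsub>M\<^esub> x \<in> H" by simp
qed

lemma simple_moduleD:
  assumes "simple_module A S"
  shows "left_module A S" "carrier S \<noteq> {\<zero>\<^bsub>S\<^esub>}"
    and "submodule H A S \<Longrightarrow> H = {\<zero>\<^bsub>S\<^esub>} \<or> H = carrier S"
  using assms by (auto simp: simple_module_def)

section \<open>Composites, inverses and differences\<close>

lemma Hom_compose:
  assumes "f \<in> Hom A L M" "g \<in> Hom A M N" "left_module A L"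
  shows "compose (carrier L) g f \<in> Hom A L N"
proof -
  interpret left_module A L by fact
  show ?thesis
    by (auto simp: Hom_def compose_def lsmult_closed HomD[OF assms(1)] HomD[OF assms(2)])
qed

text \<open>Elements of \<open>Hom\<close> are extensional, hence the restriction of
  \<open>inv_into\<close> to \<open>carrier N\<close>. Linearity of the inverse follows by computing
  \<open>f\<close> on the expected value and cancelling \<open>f\<close> with
  \<open>gf\<close>.\<close>

lemma Iso_inverse:
  assumes f: "f \<in> Iso A M N" and M: "left_module A M" and N: "left_module A N"
  shows "restrict (inv_into (carrier M) f) (carrier N) \<in> Iso A N M"
proof -
  interpret M: left_module A M by fact
  interpret N: left_module A N by fact
  let ?g = "inv_into (carrier M) f"
  have h: "f \<in> Hom A M N" and bij: "bij_betw f (carrier M) (carrier N)"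
    using f by (auto simp: Iso_def)
  have gc: "?g y \<in> carrier M" if "y \<in> carrier N" for y
    using bij that by (simp add: bij_betw_def inv_into_into)
  have fg: "f (?g y) = y" if "y \<in> carrier N" for y
    using bij that by (simp add: bij_betw_def f_inv_into_f)
  have gf: "?g (f x) = x" if "x \<in> carrier M" for x
    using bij that by (simp add: bij_betw_def)
  have "?g (x \<oplus>\<^bsub>N\<^esub> y) = ?g x \<oplus>\<^bsub>M\<^esub> ?g y" if "x \<in> carrier N" "y \<in> carrier N" for x y
    using gf[of "?g x \<oplus>\<^bsub>M\<^esub> ?g y"] that by (simp add: gc fg HomD(2)[OF h])
  moreover have "?g (a \<odot>\<^bsub>N\<^esub> x) = a \<odot>\<^bsub>M\<^esub> ?g x" if "a \<in> carrier A" "x \<in> carrier N" for a x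
    using gf[of "a \<odot>\<^bsub>M\<^esub> ?g x"] that by (simp add: gc fg HomD(3)[OF h] M.lsmult_closed)
  ultimately have "restrict ?g (carrier N) \<in> Hom A N M"
    by (auto simp: Hom_def gc N.lsmult_closed)
  moreover have "bij_betw (restrict ?g (carrier N)) (carrier N) (carrier M)"
    using bij_betw_inv_into[OF bij] by (simp cong: bij_betw_cong)
  ultimately show ?thesis by (simp add: Iso_def)
qed

lemma Iso_compose:
  assumes "f \<in> Iso A L M" "g \<in> Iso A M N" "left_module A L"
  shows "compose (carrier L) g f \<in> Iso A L N"
  using assms Hom_compose[of f A L M g N] bij_betw_trans[of f "carrier L" "carrier M" g "carrier N"]
  by (simp add: Iso_def compose_def cong: bij_betw_cong)

lemma zero_hom_Hom:
  assumes "left_module A M" "left_module A N"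
  shows "zero_hom M N \<in> Hom A M N"
proof -
  interpret M: left_module A M by fact
  interpret N: left_module A N by fact
  show ?thesis
    by (auto simp: Hom_def zero_hom_def M.lsmult_closed N.lsmult_r_zero)
qed

lemma Hom_minus:
  assumes "left_module A M" "left_module A N" "f \<in> Hom A M N" "x \<in> carrier M" "y \<in> carrier M"
  shows "f (x \<ominus>\<^bsub>M\<^esub> y) = f x \<ominus>\<^bsub>N\<^esub> f y"
proof -
  interpret M: left_module A M by fact
  interpret N: left_module A N by fact
  note f = HomD[OF assms(3)]
  have "f (\<ominus>\<^bsub>M\<^esub> y) = \<ominus>\<^bsub>N\<^esub> f y"
    using f(3)[of "\<ominus>\<^bsub>A\<^esub> \<one>\<^bsub>A\<^esub>" y] assms(5) by (simp add: M.lsmult_minus_one N.lsmult_minus_one f)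
  then show ?thesis using assms(4,5) by (simp add: a_minus_def f)
qed

section \<open>Preimages, images and kernels of homomorphisms\<close>

lemma vimage_submodule:
  assumes "left_module A M" "left_module A N" "f \<in> Hom A M N" "submodule H A N"
  shows "submodule {x \<in> carrier M. f x \<in> H} A M"
proof -
  interpret left_module A M by fact
  show ?thesis
    by (rule left_submoduleI)
      (use submoduleD[OF assms(4)] in \<open>auto simp: Hom_zero[OF assms(1-3)] HomD[OF assms(3)] lsmult_closed\<close>)
qed

lemma image_submodule:
  assumes "left_module A M" "left_module A N" "f \<in> Hom A M N" "submodule H A M"
  shows "submodule (f ` H) A N"
proof -
  interpret left_module A N by fact
  note f = HomD[OF assms(3)] and H = submoduleD[OF assms(4)]
  show ?thesis
  proof (rule left_submoduleI)
    show "\<zero>\<^bsub>N\<^esub> \<in> f ` H" using Hom_zero[OF assms(1-3)] H(2) by force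
    fix x y assume "x \<in> f ` H" "y \<in> f ` H"
    then show "x \<oplus>\<^bsub>N\<^esub> y \<in> f ` H" by (auto simp flip: f(2) simp: H)
  next
    fix a x assume "a \<in> carrier A" "x \<in> f ` H"
    then show "a \<odot>\<^bsub>N\<^esub> x \<in> f ` H" by (auto simp flip: f(3) simp: H)
  qed (use f H in auto)
qed

lemma zero_submodule:
  assumes "left_module A M"
  shows "submodule {\<zero>\<^bsub>M\<^esub>} A M"
proof -
  interpret left_module A M by fact
  show ?thesis by (rule left_submoduleI) (auto simp: lsmult_r_zero)
qed

lemma carrier_submodule:
  assumes "left_module A M"
  shows "submodule (carrier M) A M"
proof -
  interpret left_module A M by fact
  show ?thesis by (rule left_submoduleI) (auto simp: lsmult_closed)
qed

lemma kernel_submodule: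
  assumes "left_module A M" "left_module A N" "f \<in> Hom A M N"
  shows "submodule {x \<in> carrier M. f x = \<zero>\<^bsub>N\<^esub>} A M"
  using vimage_submodule[OF assms zero_submodule[OF assms(2)]] by simp

text \<open>Formulated relative to a submodule \<open>H\<close> because it is applied to a
  complement of the kernel of \<open>p\<close> as well as to whole modules.\<close>

lemma Hom_inj_onI:
  assumes "left_module A M" "left_module A N" "f \<in> Hom A M N" "submodule H A M"
    and "\<And>x. \<lbrakk>x \<in> H; f x = \<zero>\<^bsub>N\<^esub>\<rbrakk> \<Longrightarrow> x = \<zero>\<^bsub>M\<^esub>"
  shows "inj_on f H"
proof (rule inj_onI)
  interpret M: left_module A M by fact
  interpret N: left_module A N by fact
  note H = submoduleD[OF assms(4)]
  fix x y assume xy: "x \<in> H" "y \<in> H" "f x = f y"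
  have "f (x \<ominus>\<^bsub>M\<^esub> y) = \<zero>\<^bsub>N\<^esub>"
    using xy Hom_minus[OF assms(1-3)] H(1) HomD(1)[OF assms(3)] by (simp add: N.minus_eq_zero_iff)
  moreover have "x \<ominus>\<^bsub>M\<^esub> y \<in> H" using xy H by (simp add: a_minus_def)
  ultimately have "x \<ominus>\<^bsub>M\<^esub> y = \<zero>\<^bsub>M\<^esub>" by (rule assms(5)[rotated])
  then show "x = y" using xy H(1) by (simp add: M.minus_eq_zero_iff)
qed

text \<open>The universal property of the quotient of \<open>L\<close> by the kernel of
  \<open>p\<close>, phrased without quotient modules: \<open>q\<close> is constant on the fibres of
  \<open>p\<close>, so its value at any chosen preimage defines \<open>g\<close>.\<close>

lemma Hom_factor_through_surj:
  assumes L: "left_module A L" and M: "left_module A M" and N: "left_module A N"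
    and p: "p \<in> Hom A L M" "p ` carrier L = carrier M" and q: "q \<in> Hom A L N"
    and ker: "\<And>x. \<lbrakk>x \<in> carrier L; p x = \<zero>\<^bsub>M\<^esub>\<rbrakk> \<Longrightarrow> q x = \<zero>\<^bsub>N\<^esub>"
  obtains g where "g \<in> Hom A M N" "\<And>x. x \<in> carrier L \<Longrightarrow> g (p x) = q x"
proof -
  interpret L: left_module A L by fact
  interpret M: left_module A M by fact
  interpret N: left_module A N by fact
  let ?r = "inv_into (carrier L) p"
  let ?g = "\<lambda>y\<in>carrier M. q (?r y)"
  have r: "?r y \<in> carrier L" "p (?r y) = y" if "y \<in> carrier M" for y
    using that p(2) by (auto simp: inv_into_into f_inv_into_f)
  have eq: "q x = q y" if "x \<in> carrier L" "y \<in> carrier L" "p x = p y" for x y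
  proof -
    have "q (x \<ominus>\<^bsub>L\<^esub> y) = \<zero>\<^bsub>N\<^esub>"
      using that HomD(1)[OF p(1)] by (intro ker) (auto simp: Hom_minus[OF L M p(1)] M.minus_eq_zero_iff)
    then show ?thesis
      using that HomD(1)[OF q] N.minus_eq_zero_iff by (simp add: Hom_minus[OF L N q])
  qed
  have gp: "?g (p x) = q x" if "x \<in> carrier L" for x
    using that HomD(1)[OF p(1)] r by (auto intro!: eq)
  have "?g \<in> Hom A M N"
    unfolding Hom_def
  proof (safe intro!: PiE_I)
    fix x y assume xy: "x \<in> carrier M" "y \<in> carrier M"
    show "?g (x \<oplus>\<^bsub>M\<^esub> y) = ?g x \<oplus>\<^bsub>N\<^esub> ?g y"
      \<comment> \<open>The sum of the chosen preimages is a preimage of the sum, though perhaps not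
        the chosen one; \<open>gp\<close> allows any preimage.\<close>
      using gp[of "?r x \<oplus>\<^bsub>L\<^esub> ?r y"] xy r by (simp add: HomD[OF p(1)] HomD[OF q])
  next
    fix a x assume ax: "a \<in> carrier A" "x \<in> carrier M"
    show "?g (a \<odot>\<^bsub>M\<^esub> x) = a \<odot>\<^bsub>N\<^esub> ?g x"
      using gp[of "a \<odot>\<^bsub>L\<^esub> ?r x"] ax r by (simp add: HomD[OF p(1)] HomD[OF q] L.lsmult_closed)
  qed (use r HomD(1)[OF q] in auto)
  then show thesis using that gp by blast
qed

text \<open>The companion property of a submodule: a map landing in the image of \<open>i\<close>
  lifts through \<open>i\<close>. Linearity of the lift can be tested after applying the injective
  \<open>i\<close>.\<close>

lemma Hom_factor_through_inj:
  assumes L: "left_module A L" and N: "left_module A N"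
    and i: "i \<in> Hom A N M" "inj_on i (carrier N)"
    and f: "f \<in> Hom A L M" "f ` carrier L \<subseteq> i ` carrier N"
  obtains g where "g \<in> Hom A L N" "\<And>x. x \<in> carrier L \<Longrightarrow> i (g x) = f x"
proof -
  interpret L: left_module A L by fact
  interpret N: left_module A N by fact
  let ?g = "\<lambda>x\<in>carrier L. inv_into (carrier N) i (f x)"
  have g: "?g x \<in> carrier N" "i (?g x) = f x" if "x \<in> carrier L" for x
  proof -
    have "f x \<in> i ` carrier N" using that f(2) by auto
    then show "?g x \<in> carrier N" "i (?g x) = f x"
      using that by (auto simp: inv_into_into f_inv_into_f)
  qed
  have "?g \<in> Hom A L N"
    unfolding Hom_def
  proof (safe intro!: PiE_I)
    fix x y assume xy: "x \<in> carrier L" "y \<in> carrier L"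
    then show "?g (x \<oplus>\<^bsub>L\<^esub> y) = ?g x \<oplus>\<^bsub>N\<^esub> ?g y"
      by - (rule inj_onD[OF i(2)], simp_all only: g L.M.a_closed N.M.a_closed HomD[OF i(1)] HomD[OF f(1)])
  next
    fix a x assume ax: "a \<in> carrier A" "x \<in> carrier L"
    then show "?g (a \<odot>\<^bsub>L\<^esub> x) = a \<odot>\<^bsub>N\<^esub> ?g x"
      by - (rule inj_onD[OF i(2)],
        simp_all only: g L.lsmult_closed N.lsmult_closed HomD[OF i(1)] HomD[OF f(1)])
  qed (use g in auto)
  then show thesis using that g by blast
qed

text \<open>The inverse of a bijective endomorphism is again an endomorphism, so every non-zero
  element of \<open>End_algebra\<close> is a unit. That \<open>E\<close> is non-zero gives
  \<open>1 \<noteq> 0\<close>, which in turn keeps zero out of the units.\<close>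

lemma brickI:
  assumes A: "k_algebra k A" and E: "E \<in> mod_cat A" "carrier E \<noteq> {\<zero>\<^bsub>E\<^esub>}"
    and bij: "\<And>f. \<lbrakk>f \<in> Hom A E E; f \<noteq> zero_hom E E\<rbrakk> \<Longrightarrow> bij_betw f (carrier E) (carrier E)"
  shows "brick k A E"
proof -
  have lm: "left_module A E" using E by (simp add: mod_cat_def)
  interpret left_module A E by fact
  let ?D = "End_algebra A E"
  interpret D: k_algebra k ?D by (rule k_algebra_End_algebra[OF A lm])
  have car: "carrier ?D = Hom A E E" and zero: "\<zero>\<^bsub>?D\<^esub> = zero_hom E E"
    and one: "\<one>\<^bsub>?D\<^esub> = (\<lambda>x\<in>carrier E. x)"
    and mult: "\<And>f g. f \<otimes>\<^bsub>?D\<^esub> g = (\<lambda>x\<in>carrier E. f (g x))"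
    by (simp_all add: End_algebra_def)
  obtain x where x: "x \<in> carrier E" "x \<noteq> \<zero>\<^bsub>E\<^esub>" using E(2) M.zero_closed by blast
  have ne: "\<one>\<^bsub>?D\<^esub> \<noteq> \<zero>\<^bsub>?D\<^esub>"
  proof
    assume "\<one>\<^bsub>?D\<^esub> = \<zero>\<^bsub>?D\<^esub>"
    from fun_cong[OF this, of x] show False using x by (simp add: one zero zero_hom_def)
  qed
  have "f \<in> Units ?D" if f: "f \<in> carrier ?D" "f \<noteq> \<zero>\<^bsub>?D\<^esub>" for f
  proof -
    have iso: "f \<in> Iso A E E" using f bij by (simp add: Iso_def car zero)
    let ?g = "restrict (inv_into (carrier E) f) (carrier E)"
    have "?g \<in> carrier ?D" using Iso_inverse[OF iso lm lm] by (simp add: Iso_def car)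
    moreover have "?g \<otimes>\<^bsub>?D\<^esub> f = \<one>\<^bsub>?D\<^esub>" "f \<otimes>\<^bsub>?D\<^esub> ?g = \<one>\<^bsub>?D\<^esub>"
      using iso unfolding mult one
      by (auto intro!: restrict_ext simp: Iso_def bij_betw_def f_inv_into_f HomD(1))
    ultimately show ?thesis using f unfolding Units_def by blast
  qed
  moreover have "\<zero>\<^bsub>?D\<^esub> \<notin> Units ?D"
  proof
    assume "\<zero>\<^bsub>?D\<^esub> \<in> Units ?D"
    then obtain g where "g \<in> carrier ?D" "g \<otimes>\<^bsub>?D\<^esub> \<zero>\<^bsub>?D\<^esub> = \<one>\<^bsub>?D\<^esub>" unfolding Units_def by blast
    then show False using ne by simp
  qed
  moreover have "Units ?D \<subseteq> carrier ?D" by (auto simp: Units_def)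
  ultimately have "Units ?D = carrier ?D - {\<zero>\<^bsub>?D\<^esub>}" by blast
  then show ?thesis
    using E(1) ne D.k_algebra_axioms by (simp add: brick_def division_algebra_def)
qed

section \<open>Extensions of simple modules\<close>

text \<open>A fixed exact sequence \<open>0 \<rightarrow> N \<rightarrow> E \<rightarrow> M
  \<rightarrow> 0\<close>: \<open>N\<close> is the submodule and \<open>M\<close> the quotient. In
  the brick argument \<open>M\<close> is the torsion-free simple \<open>S2\<close> and
  \<open>N\<close> the torsion simple \<open>S1\<close>.\<close>

locale module_extension =
  fixes A :: "('a, 'r) ring_scheme" and M N :: "('a, 'm) module"
    and E :: "('a, 'm) module" and i p :: "'m \<Rightarrow> 'm"
  assumes left_modules: "left_module A M" "left_module A N"
    and extension: "(E, i, p) \<in> extensions A M N"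
begin

lemma E_mod_cat: "E \<in> mod_cat A" and i_Hom: "i \<in> Hom A N E" and p_Hom: "p \<in> Hom A E M"
  and inj_i: "inj_on i (carrier N)" and p_surj: "p ` carrier E = carrier M"
  and image_i: "i ` carrier N = {x \<in> carrier E. p x = \<zero>\<^bsub>M\<^esub>}"
  using extension by (auto simp: extensions_def)

lemma E_left_module: "left_module A E"
  using E_mod_cat by (simp add: mod_cat_def)

sublocale M: left_module A M by (rule left_modules)
sublocale N: left_module A N by (rule left_modules)
sublocale E: left_module A E by (rule E_left_module)

lemma p_i: "x \<in> carrier N \<Longrightarrow> p (i x) = \<zero>\<^bsub>M\<^esub>"
  using image_i by blast

lemma ker_p_E: "\<lbrakk>x \<in> carrier E; p x = \<zero>\<^bsub>M\<^esub>\<rbrakk> \<Longrightarrow> \<exists>n\<in>carrier N. x = i n"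
  using image_i by blast

text \<open>On \<open>L\<close> the map \<open>p\<close> is an isomorphism onto \<open>M\<close>;
  its inverse, viewed as a map into \<open>E\<close>, is the section.\<close>

lemma split_of_complement:
  assumes L: "submodule L A E" and pL: "p ` L = carrier M"
    and int: "\<And>x. \<lbrakk>x \<in> L; p x = \<zero>\<^bsub>M\<^esub>\<rbrakk> \<Longrightarrow> x = \<zero>\<^bsub>E\<^esub>"
  shows "(E, i, p) \<in> Ext1_zero A M N"
proof -
  note LD = submoduleD[OF L]
  have inj: "inj_on p L"
    by (rule Hom_inj_onI[OF E_left_module left_modules(1) p_Hom L int])
  let ?s = "\<lambda>x\<in>carrier M. inv_into L p x"
  have s: "?s x \<in> L" "?s x \<in> carrier E" "p (?s x) = x" if "x \<in> carrier M" for x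
    using that pL LD(1)[of "inv_into L p x"] by (auto simp: inv_into_into f_inv_into_f)
  have "?s \<in> Hom A M E"
    unfolding Hom_def
  proof (safe intro!: PiE_I)
    fix x y assume "x \<in> carrier M" "y \<in> carrier M"
    then show "?s (x \<oplus>\<^bsub>M\<^esub> y) = ?s x \<oplus>\<^bsub>E\<^esub> ?s y"
      by - (rule inj_onD[OF inj], simp_all only: s LD M.M.a_closed HomD[OF p_Hom])
  next
    fix a x assume "a \<in> carrier A" "x \<in> carrier M"
    then show "?s (a \<odot>\<^bsub>M\<^esub> x) = a \<odot>\<^bsub>E\<^esub> ?s x"
      by - (rule inj_onD[OF inj], simp_all only: s LD M.lsmult_closed HomD[OF p_Hom])
  qed (use s in auto)
  then show ?thesis
    using extension s(3) unfolding Ext1_zero_def by blast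
qed

text \<open>By simplicity, both the image of \<open>L\<close> in \<open>M\<close> and the preimage
  of \<open>L\<close> in \<open>N\<close> are zero or everything. The pair determines
  \<open>L\<close>, except that zero preimage with full image would make \<open>L\<close> a
  complement of \<open>N\<close>, and the sequence would split.\<close>

lemma submodules_of_nonsplit:
  assumes simple: "simple_module A M" "simple_module A N"
    and nonsplit: "(E, i, p) \<notin> Ext1_zero A M N" and L: "submodule L A E"
  shows "L = {\<zero>\<^bsub>E\<^esub>} \<or> L = i ` carrier N \<or> L = carrier E"
proof -
  note LD = submoduleD[OF L]
  have pL: "p ` L = {\<zero>\<^bsub>M\<^esub>} \<or> p ` L = carrier M"
    by (rule simple_moduleD(3)[OF simple(1) image_submodule[OF E_left_module left_modules(1) p_Hom L]])
  have "{x \<in> carrier N. i x \<in> L} = {\<zero>\<^bsub>N\<^esub>} \<or> {x \<in> carrier N. i x \<in> L} = carrier N"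
    by (rule simple_moduleD(3)[OF simple(2) vimage_submodule[OF left_modules(2) E_left_module i_Hom L]])
  then show ?thesis
  proof
    assume triv: "{x \<in> carrier N. i x \<in> L} = {\<zero>\<^bsub>N\<^esub>}"
    have int: "x = \<zero>\<^bsub>E\<^esub>" if x: "x \<in> L" "p x = \<zero>\<^bsub>M\<^esub>" for x
    proof -
      obtain n where n: "n \<in> carrier N" "x = i n" using ker_p_E x LD(1) by blast
      then have "n = \<zero>\<^bsub>N\<^esub>" using triv x(1) by blast
      then show ?thesis using n(2) Hom_zero[OF left_modules(2) E_left_module i_Hom] by simp
    qed
    have "p ` L \<noteq> carrier M" using split_of_complement[OF L _ int] nonsplit by blast
    then have "p ` L = {\<zero>\<^bsub>M\<^esub>}" using pL by blast
    then have "L = {\<zero>\<^bsub>E\<^esub>}" using int LD(2) by blast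
    then show ?thesis by blast
  next
    assume "{x \<in> carrier N. i x \<in> L} = carrier N"
    then have sub: "i ` carrier N \<subseteq> L" by blast
    show ?thesis using pL
    proof
      assume "p ` L = {\<zero>\<^bsub>M\<^esub>}"
      then have "L \<subseteq> i ` carrier N" using image_i LD(1) by blast
      then show ?thesis using sub by blast
    next
      assume pL: "p ` L = carrier M"
      have "x \<in> L" if x: "x \<in> carrier E" for x
      proof -
        \<comment> \<open>Correct \<open>x\<close> by an element \<open>y\<close> of
          \<open>L\<close> with the same image: the difference lies in the kernel of
          \<open>p\<close>, which is contained in \<open>L\<close>.\<close>
        have "p x \<in> p ` L" using pL HomD(1)[OF p_Hom x] by simp
        then obtain y where y: "y \<in> L" "p x = p y" by blast
        have yE: "y \<in> carrier E" using y LD(1) by blast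
        have "p (x \<ominus>\<^bsub>E\<^esub> y) = \<zero>\<^bsub>M\<^esub>"
          using x yE y HomD(1)[OF p_Hom]
          by (simp add: Hom_minus[OF E_left_module left_modules(1) p_Hom] M.minus_eq_zero_iff)
        then have "x \<ominus>\<^bsub>E\<^esub> y \<in> L" using sub image_i x yE by blast
        then have "(x \<ominus>\<^bsub>E\<^esub> y) \<oplus>\<^bsub>E\<^esub> y \<in> L" using y LD(3) by blast
        moreover have "(x \<ominus>\<^bsub>E\<^esub> y) \<oplus>\<^bsub>E\<^esub> y = x"
          using x yE by (simp add: a_minus_def E.M.a_assoc E.M.l_neg)
        ultimately show ?thesis by simp
      qed
      then show ?thesis using LD(1) by blast
    qed
  qed
qed

lemma nontrivial:
  assumes "simple_module A M"
  shows "carrier E \<noteq> {\<zero>\<^bsub>E\<^esub>}"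
proof
  assume "carrier E = {\<zero>\<^bsub>E\<^esub>}"
  then have "carrier M = {\<zero>\<^bsub>M\<^esub>}"
    using p_surj Hom_zero[OF E_left_module left_modules(1) p_Hom] by simp
  then show False using simple_moduleD(2)[OF assms] by simp
qed

text \<open>Since \<open>f\<close> is non-zero, its kernel is not \<open>E\<close> and its image is
  not zero. It remains to exclude the submodule \<open>N\<close> as kernel, giving injectivity, and
  then as image, giving surjectivity.\<close>

lemma nonsplit_endomorphism_bij:
  assumes simple: "simple_module A M" "simple_module A N"
    and Hom0: "Hom A N M = {zero_hom N M}"
    and nonsplit: "(E, i, p) \<notin> Ext1_zero A M N"
    and f: "f \<in> Hom A E E" and fne: "f \<noteq> zero_hom E E"
  shows "bij_betw f (carrier E) (carrier E)"
proof -
  obtain n where n: "n \<in> carrier N" "n \<noteq> \<zero>\<^bsub>N\<^esub>"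
    using simple_moduleD(2)[OF simple(2)] N.M.zero_closed by blast
  obtain m where m: "m \<in> carrier M" "m \<noteq> \<zero>\<^bsub>M\<^esub>"
    using simple_moduleD(2)[OF simple(1)] M.M.zero_closed by blast
  have i0: "i \<zero>\<^bsub>N\<^esub> = \<zero>\<^bsub>E\<^esub>" by (rule Hom_zero[OF left_modules(2) E_left_module i_Hom])
  have iE: "i x \<in> carrier E" if "x \<in> carrier N" for x using HomD(1)[OF i_Hom] that .
  have in0: "i n \<noteq> \<zero>\<^bsub>E\<^esub>"
    using n i0 inj_onD[OF inj_i, of n "\<zero>\<^bsub>N\<^esub>"] by auto
  \<comment> \<open>This \<open>e\<close> lies outside \<open>N\<close>, so \<open>N\<close> is a
    proper submodule; it later also shows that a factor of \<open>p\<close> cannot vanish.\<close>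
  obtain e where e: "e \<in> carrier E" "p e = m" using m(1) p_surj by (metis imageE)
  have NE: "i ` carrier N \<noteq> carrier E" using image_i e m(2) by auto
  note subs = submodules_of_nonsplit[OF simple nonsplit]
  \<comment> \<open>\<open>N\<close> is stable under \<open>f\<close>: the composite
    \<open>p f i\<close> lies in \<open>Hom A N M\<close> and is therefore zero.\<close>
  have f_iN: "f x \<in> i ` carrier N" if x: "x \<in> i ` carrier N" for x
  proof -
    obtain y where y: "y \<in> carrier N" "x = i y" using x by blast
    have "compose (carrier N) (compose (carrier E) p f) i \<in> Hom A N M"
      by (intro Hom_compose[OF i_Hom] Hom_compose[OF f p_Hom] left_modules E_left_module)
    then have "compose (carrier N) (compose (carrier E) p f) i = zero_hom N M" using Hom0 by blast
    from fun_cong[OF this, of y] have "p (f x) = \<zero>\<^bsub>M\<^esub>"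
      using y iE by (simp add: compose_def zero_hom_def)
    then show ?thesis using image_i HomD(1)[OF f] iE y by simp
  qed
  let ?K = "{x \<in> carrier E. f x = \<zero>\<^bsub>E\<^esub>}"
  have K: "?K = {\<zero>\<^bsub>E\<^esub>} \<or> ?K = i ` carrier N \<or> ?K = carrier E"
    by (rule subs[OF kernel_submodule[OF E_left_module E_left_module f]])
  have "?K \<noteq> carrier E"
  proof
    assume K: "?K = carrier E"
    have "f = zero_hom E E"
      by (rule Hom_ext[OF f zero_hom_Hom[OF E_left_module E_left_module]])
        (use K in \<open>auto simp: zero_hom_def\<close>)
    then show False using fne by blast
  qed
  let ?P = "{x \<in> carrier E. f x \<in> i ` carrier N}"
  have "submodule (i ` carrier N) A E"
    by (rule image_submodule[OF left_modules(2) E_left_module i_Hom carrier_submodule[OF left_modules(2)]])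
  then have P: "?P = {\<zero>\<^bsub>E\<^esub>} \<or> ?P = i ` carrier N \<or> ?P = carrier E"
    by (intro subs vimage_submodule[OF E_left_module E_left_module f])
  have im: "f ` carrier E = {\<zero>\<^bsub>E\<^esub>} \<or> f ` carrier E = i ` carrier N \<or> f ` carrier E = carrier E"
    by (intro subs image_submodule[OF E_left_module E_left_module f] carrier_submodule E_left_module)
  have im0: "f ` carrier E \<noteq> {\<zero>\<^bsub>E\<^esub>}" using \<open>?K \<noteq> carrier E\<close> by blast
  have "?K \<noteq> i ` carrier N"
  proof
    assume K: "?K = i ` carrier N"
    show False
    \<comment> \<open>If kernel and image of \<open>f\<close> agree, then \<open>N \<cong> E/N \<cong> M\<close>, against \<open>Hom(N, M) = 0\<close>.\<close>
    proof (cases "f ` carrier E = i ` carrier N")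
      case True
      then obtain q where q: "q \<in> Hom A E N" "\<And>x. x \<in> carrier E \<Longrightarrow> i (q x) = f x"
        using Hom_factor_through_inj[OF E_left_module left_modules(2) i_Hom inj_i f] by blast
      have "q ` carrier E = carrier N"
      proof
        show "q ` carrier E \<subseteq> carrier N" using HomD(1)[OF q(1)] by blast
        show "carrier N \<subseteq> q ` carrier E"
        proof
          fix y assume y: "y \<in> carrier N"
          then have "i y \<in> f ` carrier E" using True by simp
          then obtain x where x: "x \<in> carrier E" "i y = f x" by blast
          then have "q x = y"
            using inj_onD[OF inj_i, of "q x" y] HomD(1)[OF q(1)] q(2) y by simp
          then show "y \<in> q ` carrier E" using x by blast
        qed
      qed
      moreover have "p x = \<zero>\<^bsub>M\<^esub>" if "x \<in> carrier E" "q x = \<zero>\<^bsub>N\<^esub>" for x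
      proof -
        have "x \<in> ?K" using that q(2)[of x] i0 by simp
        then show ?thesis using K image_i by blast
      qed
      ultimately obtain g where g: "g \<in> Hom A N M" "\<And>x. x \<in> carrier E \<Longrightarrow> g (q x) = p x"
        using Hom_factor_through_surj[OF E_left_module left_modules(2,1) q(1) _ p_Hom] by blast
      have "g (q e) = \<zero>\<^bsub>M\<^esub>"
        using g(1) Hom0 HomD(1)[OF q(1) e(1)] by (simp add: zero_hom_def)
      then show False using g(2) e m(2) by simp
    next
      case False
      then have surj: "f ` carrier E = carrier E" using im im0 by blast
      \<comment> \<open>Here \<open>f\<close> is onto with kernel \<open>N\<close>. The preimage
        \<open>?P\<close> of \<open>N\<close> is proper and non-zero, hence equals \<open>N\<close>,
        the kernel; but then \<open>f\<close> maps \<open>?P\<close> to zero and cannot reach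
        \<open>i n\<close>.\<close>
      have "?P \<noteq> carrier E"
      proof
        assume "?P = carrier E"
        then have "f ` carrier E \<subseteq> i ` carrier N" by blast
        then show False using surj iE NE by auto
      qed
      moreover have "?P \<noteq> {\<zero>\<^bsub>E\<^esub>}" using f_iN iE n(1) in0 by blast
      ultimately have P: "?P = i ` carrier N" using P by simp
      have "i n \<in> f ` carrier E" using surj iE n(1) by simp
      then obtain x where x: "x \<in> carrier E" "i n = f x" by blast
      have "f x \<in> i ` carrier N" using x(2) n(1) by (metis imageI)
      then have "x \<in> ?K" using x(1) P K by blast
      then show False using x in0 by simp
    qed
  qed
  then have K: "?K = {\<zero>\<^bsub>E\<^esub>}" using K \<open>?K \<noteq> carrier E\<close> by blast
  then have inj: "inj_on f (carrier E)"
    by (intro Hom_inj_onI[OF E_left_module E_left_module f] carrier_submodule E_left_module) blast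
  \<comment> \<open>If the image were \<open>N\<close>, the non-zero submodule \<open>f(N)\<close>
    of \<open>N\<close> would be \<open>N\<close> itself, that is, \<open>f(E)\<close>; injectivity
    of \<open>f\<close> would give \<open>N = E\<close>.\<close>
  have "f ` carrier E \<noteq> i ` carrier N"
  proof
    assume im: "f ` carrier E = i ` carrier N"
    have sub: "submodule (f ` (i ` carrier N)) A E"
      using \<open>submodule (i ` carrier N) A E\<close> by (rule image_submodule[OF E_left_module E_left_module f])
    have "f (i n) \<noteq> \<zero>\<^bsub>E\<^esub>" using K iE[OF n(1)] in0 by blast
    then have "f ` (i ` carrier N) \<noteq> {\<zero>\<^bsub>E\<^esub>}" using n(1) by blast
    moreover have "f ` (i ` carrier N) \<subseteq> i ` carrier N" using f_iN by blast
    ultimately have "f ` (i ` carrier N) = i ` carrier N"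
      using subs[OF sub] NE image_i by blast
    then have "f ` (i ` carrier N) = f ` carrier E" using im by simp
    then have "i ` carrier N = carrier E"
      using inj_on_image_eq_iff[OF inj, of "i ` carrier N" "carrier E"] iE by blast
    then show False using NE by blast
  qed
  then show ?thesis
    using inj im im0 by (simp add: bij_betw_def)
qed

end

section \<open>Split extensions\<close>

text \<open>Since its elements are pairs, the sum of two objects over \<open>'m\<close> is not an
  object over \<open>'m\<close>; it serves as a model to be transported.\<close>

definition direct_sum :: "('a, 'n) module \<Rightarrow> ('a, 'm) module \<Rightarrow> ('a, 'n \<times> 'm) module" where
  "direct_sum N M =
    \<lparr> carrier = carrier N \<times> carrier M, mult = undefined, one = undefined,
      zero = (\<zero>\<^bsub>N\<^esub>, \<zero>\<^bsub>M\<^esub>),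
      add = (\<lambda>x y. (fst x \<oplus>\<^bsub>N\<^esub> fst y, snd x \<oplus>\<^bsub>M\<^esub> snd y)),
      smult = (\<lambda>a x. (a \<odot>\<^bsub>N\<^esub> fst x, a \<odot>\<^bsub>M\<^esub> snd x)) \<rparr>"

lemma direct_sum_simps [simp]:
  "carrier (direct_sum N M) = carrier N \<times> carrier M"
  "\<zero>\<^bsub>direct_sum N M\<^esub> = (\<zero>\<^bsub>N\<^esub>, \<zero>\<^bsub>M\<^esub>)"
  "x \<oplus>\<^bsub>direct_sum N M\<^esub> y = (fst x \<oplus>\<^bsub>N\<^esub> fst y, snd x \<oplus>\<^bsub>M\<^esub> snd y)"
  "a \<odot>\<^bsub>direct_sum N M\<^esub> x = (a \<odot>\<^bsub>N\<^esub> fst x, a \<odot>\<^bsub>M\<^esub> snd x)"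
  by (simp_all add: direct_sum_def)

lemma left_module_direct_sum:
  assumes "left_module A N" "left_module A M"
  shows "left_module A (direct_sum N M)"
proof -
  interpret N: left_module A N by fact
  interpret M: left_module A M by fact
  have "abelian_group (direct_sum N M)"
  proof (rule abelian_groupI)
    fix x assume "x \<in> carrier (direct_sum N M)"
    then show "\<exists>y\<in>carrier (direct_sum N M). y \<oplus>\<^bsub>direct_sum N M\<^esub> x = \<zero>\<^bsub>direct_sum N M\<^esub>"
      by (intro bexI[of _ "(\<ominus>\<^bsub>N\<^esub> fst x, \<ominus>\<^bsub>M\<^esub> snd x)"]) (auto simp: N.M.l_neg M.M.l_neg)
  qed (auto simp: N.M.a_ac M.M.a_ac)
  then show ?thesis
    by (intro left_module.intro left_module_axioms.intro N.ring_axioms)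
      (auto simp: N.lsmult_closed N.lsmult_l_distr N.lsmult_r_distr N.lsmult_assoc N.lsmult_one
        M.lsmult_closed M.lsmult_l_distr M.lsmult_r_distr M.lsmult_assoc M.lsmult_one)
qed

lemma direct_sum_Hom:
  assumes "left_module A N" "left_module A M"
  shows "(\<lambda>x\<in>carrier N. (x, \<zero>\<^bsub>M\<^esub>)) \<in> Hom A N (direct_sum N M)"
    and "(\<lambda>y\<in>carrier M. (\<zero>\<^bsub>N\<^esub>, y)) \<in> Hom A M (direct_sum N M)"
    and "(\<lambda>z\<in>carrier (direct_sum N M). snd z) \<in> Hom A (direct_sum N M) M"
proof -
  interpret N: left_module A N by fact
  interpret M: left_module A M by fact
  show "(\<lambda>x\<in>carrier N. (x, \<zero>\<^bsub>M\<^esub>)) \<in> Hom A N (direct_sum N M)"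
    "(\<lambda>y\<in>carrier M. (\<zero>\<^bsub>N\<^esub>, y)) \<in> Hom A M (direct_sum N M)"
    "(\<lambda>z\<in>carrier (direct_sum N M). snd z) \<in> Hom A (direct_sum N M) M"
    by (auto simp: Hom_def N.lsmult_closed M.lsmult_closed N.lsmult_r_zero M.lsmult_r_zero)
qed

text \<open>Generators of the summands, embedded by the two inclusions, generate the sum. As
  \<open>fin_gen\<close> asks for one coefficient function on the generating set, the two
  coefficient functions are glued, which requires disjoint images.\<close>

lemma fin_gen_direct_sum:
  assumes N: "left_module A N" "fin_gen A N" and M: "left_module A M" "fin_gen A M"
  shows "fin_gen A (direct_sum N M)"
proof -
  interpret N: left_module A N by fact
  interpret M: left_module A M by fact
  let ?D = "direct_sum N M"
  have Dlm: "left_module A ?D" by (rule left_module_direct_sum[OF N(1) M(1)])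
  interpret D: left_module A ?D by (rule Dlm)
  obtain G where G: "finite G" "G \<subseteq> carrier N"
    "\<And>x. x \<in> carrier N \<Longrightarrow> \<exists>c\<in>G \<rightarrow> carrier A. x = (\<Oplus>\<^bsub>N\<^esub>g\<in>G. c g \<odot>\<^bsub>N\<^esub> g)"
    using N(2) by (auto simp: fin_gen_def)
  obtain H where H: "finite H" "H \<subseteq> carrier M"
    "\<And>x. x \<in> carrier M \<Longrightarrow> \<exists>c\<in>H \<rightarrow> carrier A. x = (\<Oplus>\<^bsub>M\<^esub>g\<in>H. c g \<odot>\<^bsub>M\<^esub> g)"
    using M(2) by (auto simp: fin_gen_def)
  \<comment> \<open>Without \<open>0\<close> in the second generating set the images of the two sets are disjoint.\<close>
  let ?H = "H - {\<zero>\<^bsub>M\<^esub>}"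
  let ?i = "\<lambda>x\<in>carrier N. (x, \<zero>\<^bsub>M\<^esub>)" and ?j = "\<lambda>y\<in>carrier M. (\<zero>\<^bsub>N\<^esub>, y)"
  note ij = direct_sum_Hom(1,2)[OF N(1) M(1)]
  have img: "?i ` G \<subseteq> carrier ?D" "?j ` ?H \<subseteq> carrier ?D" using G H by auto
  have dis: "?i ` G \<inter> ?j ` ?H = {}" using G H by (auto simp: subset_iff)
  show ?thesis unfolding fin_gen_def
  proof (intro exI[of _ "?i ` G \<union> ?j ` ?H"] conjI ballI)
    fix z assume "z \<in> carrier ?D"
    then obtain x y where z: "z = (x, y)" "x \<in> carrier N" "y \<in> carrier M" by auto
    obtain c where c: "c \<in> G \<rightarrow> carrier A" "x = (\<Oplus>\<^bsub>N\<^esub>g\<in>G. c g \<odot>\<^bsub>N\<^esub> g)" using G(3) z by blast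
    obtain d where d: "d \<in> H \<rightarrow> carrier A" "y = (\<Oplus>\<^bsub>M\<^esub>h\<in>H. d h \<odot>\<^bsub>M\<^esub> h)" using H(3) z by blast
    \<comment> \<open>The second component tells the two sets of generators apart: it is zero
      exactly on those coming from \<open>N\<close>.\<close>
    let ?c = "\<lambda>w. if snd w = \<zero>\<^bsub>M\<^esub> then c (fst w) else d (snd w)"
    have ci: "?c (?i g) = c g" if "g \<in> G" for g using that G(2) by auto
    have cj: "?c (?j h) = d h" if "h \<in> ?H" for h using that H(2) by auto
    have cA: "?c \<in> ?i ` G \<rightarrow> carrier A" "?c \<in> ?j ` ?H \<rightarrow> carrier A"
      using c(1) d(1) G(2) H(2) by (auto split: if_splits)
    have closed: "(\<lambda>w. ?c w \<odot>\<^bsub>?D\<^esub> w) \<in> ?i ` G \<rightarrow> carrier ?D" "(\<lambda>w. ?c w \<odot>\<^bsub>?D\<^esub> w) \<in> ?j ` ?H \<rightarrow> carrier ?D"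
      using cA img by (intro funcsetI D.lsmult_closed; blast)+
    have "?i x = (\<Oplus>\<^bsub>?D\<^esub>g\<in>G. c g \<odot>\<^bsub>?D\<^esub> ?i g)"
      using Hom_finsum[OF N(1) Dlm ij(1) G(1) c(1), of "\<lambda>g. g"] G(2) c(2) by blast
    also have "\<dots> = (\<Oplus>\<^bsub>?D\<^esub>g\<in>G. ?c (?i g) \<odot>\<^bsub>?D\<^esub> ?i g)"
      by (rule D.M.finsum_cong') (use ci closed in \<open>auto simp del: restrict_apply direct_sum_simps\<close>)
    also have "\<dots> = (\<Oplus>\<^bsub>?D\<^esub>w\<in>?i ` G. ?c w \<odot>\<^bsub>?D\<^esub> w)"
      by (rule D.M.finsum_reindex[symmetric, OF closed(1)]) (use G(2) in \<open>auto simp: inj_on_def\<close>)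
    finally have 1: "?i x = (\<Oplus>\<^bsub>?D\<^esub>w\<in>?i ` G. ?c w \<odot>\<^bsub>?D\<^esub> w)" .
    \<comment> \<open>Dropping the generator zero only removes a zero summand.\<close>
    have "y = (\<Oplus>\<^bsub>M\<^esub>h\<in>?H. d h \<odot>\<^bsub>M\<^esub> h)"
      unfolding d(2) using H d(1)
      by (intro M.M.add.finprod_mono_neutral_cong_right) (auto simp: M.lsmult_r_zero Pi_iff intro!: M.lsmult_closed)
    then have "?j y = (\<Oplus>\<^bsub>?D\<^esub>h\<in>?H. d h \<odot>\<^bsub>?D\<^esub> ?j h)"
      using Hom_finsum[OF M(1) Dlm ij(2), of ?H d "\<lambda>g. g"] H(1,2) d(1) by blast
    also have "\<dots> = (\<Oplus>\<^bsub>?D\<^esub>h\<in>?H. ?c (?j h) \<odot>\<^bsub>?D\<^esub> ?j h)"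
      by (rule D.M.finsum_cong') (use cj closed in \<open>auto simp del: restrict_apply direct_sum_simps\<close>)
    also have "\<dots> = (\<Oplus>\<^bsub>?D\<^esub>w\<in>?j ` ?H. ?c w \<odot>\<^bsub>?D\<^esub> w)"
      by (rule D.M.finsum_reindex[symmetric, OF closed(2)]) (use H(2) in \<open>auto simp: inj_on_def\<close>)
    finally have 2: "?j y = (\<Oplus>\<^bsub>?D\<^esub>w\<in>?j ` ?H. ?c w \<odot>\<^bsub>?D\<^esub> w)" .
    have "z = ?i x \<oplus>\<^bsub>?D\<^esub> ?j y" using z by simp
    also have "\<dots> = (\<Oplus>\<^bsub>?D\<^esub>w\<in>?i ` G \<union> ?j ` ?H. ?c w \<odot>\<^bsub>?D\<^esub> w)"
      unfolding 1 2 by (rule D.M.finsum_Un_disjoint[symmetric]) (use G(1) H(1) dis closed in auto)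
    finally show "\<exists>c\<in>?i ` G \<union> ?j ` ?H \<rightarrow> carrier A. z = (\<Oplus>\<^bsub>?D\<^esub>w\<in>?i ` G \<union> ?j ` ?H. c w \<odot>\<^bsub>?D\<^esub> w)"
      using cA by (intro bexI[of _ ?c]) blast+
  qed (use G(1) H(1) img in auto)
qed

text \<open>Because \<open>p i = 0\<close> and \<open>p s = id\<close>, applying \<open>p\<close> to
  \<open>i x + s y\<close> recovers \<open>y\<close>, and injectivity of \<open>i\<close> then gives
  \<open>x\<close>. For surjectivity, write \<open>e = (e - s (p e)) + s (p e)\<close>, where the
  first term lies in the kernel of \<open>p\<close>, hence in \<open>N\<close>.\<close>

lemma split_extension_Iso_direct_sum:
  assumes lm: "left_module A M" "left_module A N" and ext: "(E, i, p) \<in> extensions A M N"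
    and s: "s \<in> Hom A M E" "\<And>x. x \<in> carrier M \<Longrightarrow> p (s x) = x"
  shows "(\<lambda>z\<in>carrier (direct_sum N M). i (fst z) \<oplus>\<^bsub>E\<^esub> s (snd z)) \<in> Iso A (direct_sum N M) E"
    (is "?h \<in> _")
proof -
  interpret module_extension A M N E i p by (rule module_extension.intro[OF lm ext])
  interpret D: left_module A "direct_sum N M" by (rule left_module_direct_sum[OF lm(2,1)])
  note closed = HomD(1)[OF i_Hom] HomD(1)[OF s(1)] HomD(1)[OF p_Hom]
  have h: "?h \<in> Hom A (direct_sum N M) E"
    unfolding Hom_def
  proof (safe intro!: PiE_I)
    fix x y x' y' assume xy: "(x, y) \<in> carrier (direct_sum N M)" "(x', y') \<in> carrier (direct_sum N M)"
    then have "?h ((x, y) \<oplus>\<^bsub>direct_sum N M\<^esub> (x', y')) = (i x \<oplus>\<^bsub>E\<^esub> i x') \<oplus>\<^bsub>E\<^esub> (s y \<oplus>\<^bsub>E\<^esub> s y')"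
      by (simp add: HomD(2)[OF i_Hom] HomD(2)[OF s(1)])
    also have "\<dots> = (i x \<oplus>\<^bsub>E\<^esub> s y) \<oplus>\<^bsub>E\<^esub> (i x' \<oplus>\<^bsub>E\<^esub> s y')"
      using xy by (simp add: closed E.M.a_ac)
    finally show "?h ((x, y) \<oplus>\<^bsub>direct_sum N M\<^esub> (x', y')) = ?h (x, y) \<oplus>\<^bsub>E\<^esub> ?h (x', y')"
      using xy by simp
  next
    fix a x y assume "a \<in> carrier A" "(x, y) \<in> carrier (direct_sum N M)"
    then show "?h (a \<odot>\<^bsub>direct_sum N M\<^esub> (x, y)) = a \<odot>\<^bsub>E\<^esub> ?h (x, y)"
      by (simp add: closed HomD(3)[OF i_Hom] HomD(3)[OF s(1)] E.lsmult_r_distr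
          N.lsmult_closed M.lsmult_closed)
  qed (auto simp: closed)
  have ph: "p (?h (x, y)) = y" if "x \<in> carrier N" "y \<in> carrier M" for x y
    using that by (simp add: closed HomD(2)[OF p_Hom] p_i s(2))
  have "inj_on ?h (carrier (direct_sum N M))"
  proof (rule Hom_inj_onI[OF D.left_module_axioms E_left_module h carrier_submodule[OF D.left_module_axioms]])
    fix z assume z: "z \<in> carrier (direct_sum N M)" "?h z = \<zero>\<^bsub>E\<^esub>"
    then obtain x y where xy: "z = (x, y)" "x \<in> carrier N" "y \<in> carrier M" by auto
    have y: "y = \<zero>\<^bsub>M\<^esub>"
      using ph[OF xy(2,3)] z(2) xy(1) Hom_zero[OF E_left_module lm(1) p_Hom] by simp
    then have "i x = i \<zero>\<^bsub>N\<^esub>"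
      using z(2) xy Hom_zero[OF lm(1) E_left_module s(1)] Hom_zero[OF lm(2) E_left_module i_Hom] closed
      by simp
    then show "z = \<zero>\<^bsub>direct_sum N M\<^esub>" using inj_onD[OF inj_i] xy y by simp
  qed
  moreover have "?h ` carrier (direct_sum N M) = carrier E"
  proof
    show "?h ` carrier (direct_sum N M) \<subseteq> carrier E" using HomD(1)[OF h] by blast
    show "carrier E \<subseteq> ?h ` carrier (direct_sum N M)"
    proof
      fix e assume e: "e \<in> carrier E"
      let ?s = "s (p e)"
      have sE: "?s \<in> carrier E" using e closed by blast
      have "p (e \<ominus>\<^bsub>E\<^esub> ?s) = \<zero>\<^bsub>M\<^esub>"
        using e closed s(2) sE
        by (simp add: Hom_minus[OF E_left_module lm(1) p_Hom] M.minus_eq_zero_iff)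
      then obtain n where n: "n \<in> carrier N" "e \<ominus>\<^bsub>E\<^esub> ?s = i n"
        using ker_p_E[of "e \<ominus>\<^bsub>E\<^esub> ?s"] e sE by auto
      have "e = (e \<ominus>\<^bsub>E\<^esub> ?s) \<oplus>\<^bsub>E\<^esub> ?s" using e sE by (simp add: a_minus_def E.M.a_assoc E.M.l_neg)
      also have "\<dots> = ?h (n, p e)" using n e closed by simp
      finally show "e \<in> ?h ` carrier (direct_sum N M)"
        using n(1) e closed by (intro image_eqI[of _ _ "(n, p e)"]) auto
    qed
  qed
  ultimately show ?thesis using h by (simp add: Iso_def bij_betw_def)
qed

text \<open>Comparing both middle terms with the direct sum gives the isomorphism \<open>h\<close>
  with \<open>h (i x + s y) = i' x + s' y\<close>. Putting \<open>y = 0\<close> shows that it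
  respects the inclusions; both projections send the respective element to \<open>y\<close>.\<close>

lemma split_extensions_equiv:
  assumes lm: "left_module A M" "left_module A N"
    and X: "X \<in> Ext1_zero A M N" and Y: "Y \<in> Ext1_zero A M N"
  shows "(X, Y) \<in> extension_equiv A M N"
proof -
  obtain E i p s where E: "X = (E, i, p)" "(E, i, p) \<in> extensions A M N"
    and s: "s \<in> Hom A M E" "\<And>x. x \<in> carrier M \<Longrightarrow> p (s x) = x"
    using X by (auto simp: Ext1_zero_def)
  obtain E' i' p' s' where E': "Y = (E', i', p')" "(E', i', p') \<in> extensions A M N"
    and s': "s' \<in> Hom A M E'" "\<And>x. x \<in> carrier M \<Longrightarrow> p' (s' x) = x"
    using Y by (auto simp: Ext1_zero_def)
  interpret E: module_extension A M N E i p by (rule module_extension.intro[OF lm E(2)])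
  interpret E': module_extension A M N E' i' p' by (rule module_extension.intro[OF lm E'(2)])
  let ?D = "direct_sum N M"
  have D: "left_module A ?D" by (rule left_module_direct_sum[OF lm(2,1)])
  let ?f = "\<lambda>z\<in>carrier ?D. i (fst z) \<oplus>\<^bsub>E\<^esub> s (snd z)"
  let ?g = "\<lambda>z\<in>carrier ?D. i' (fst z) \<oplus>\<^bsub>E'\<^esub> s' (snd z)"
  have f: "?f \<in> Iso A ?D E" by (rule split_extension_Iso_direct_sum[OF lm E(2) s])
  have g: "?g \<in> Iso A ?D E'" by (rule split_extension_Iso_direct_sum[OF lm E'(2) s'])
  define r where "r = restrict (inv_into (carrier ?D) ?f) (carrier E)"
  define h where "h = compose (carrier E) ?g r"
  have hI: "h \<in> Iso A E E'"
    unfolding h_def r_def by (rule Iso_compose[OF Iso_inverse[OF f D E.E_left_module] g E.E_left_module])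
  note cl = HomD(1)[OF E.i_Hom] HomD(1)[OF s(1)] HomD(1)[OF E'.i_Hom] HomD(1)[OF s'(1)]
  have bij: "bij_betw ?f (carrier ?D) (carrier E)" using f by (simp add: Iso_def)
  have hf: "h (i x \<oplus>\<^bsub>E\<^esub> s y) = i' x \<oplus>\<^bsub>E'\<^esub> s' y" if xy: "x \<in> carrier N" "y \<in> carrier M" for x y
  proof -
    have "r (?f (x, y)) = (x, y)"
      using xy bij cl by (simp add: r_def bij_betw_def inv_into_f_eq)
    then show ?thesis using xy cl by (simp add: h_def compose_def)
  qed
  have "h (i x) = i' x" if "x \<in> carrier N" for x
    using hf[of x "\<zero>\<^bsub>M\<^esub>"] that cl Hom_zero[OF lm(1) E.E_left_module s(1)]
      Hom_zero[OF lm(1) E'.E_left_module s'(1)] by simp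
  moreover have "p' (h e) = p e" if "e \<in> carrier E" for e
  proof -
    have "e \<in> ?f ` carrier ?D" using bij that unfolding bij_betw_def by simp
    then obtain x y where xy: "x \<in> carrier N" "y \<in> carrier M" "e = i x \<oplus>\<^bsub>E\<^esub> s y" by auto
    then show ?thesis
      by (simp add: hf cl HomD(2)[OF E.p_Hom] HomD(2)[OF E'.p_Hom] E.p_i E'.p_i s(2) s'(2))
  qed
  ultimately show ?thesis
    unfolding extension_equiv_def E(1) E'(1) using E(2) E'(2) hI by blast
qed

text \<open>Without any extension over \<open>'m\<close> the quotient \<open>Ext1\<close> would be
  empty rather than a singleton. The map \<open>\<iota>\<close> provides a copy \<open>E\<close> of
  the direct sum over \<open>'m\<close>, and the inclusions and the projection are transported along
  the isomorphism \<open>h\<close>.\<close>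

lemma Ext1_zero_nonempty:
  fixes M N :: "('a, 'm) module" and \<iota> :: "'k list \<Rightarrow> 'm"
  assumes A: "fin_dim_algebra k A" "inj_on \<iota> (lists (carrier k))"
    and "M \<in> mod_cat A" "N \<in> mod_cat A"
  shows "Ext1_zero A M N \<noteq> {}"
proof -
  have lm: "left_module A M" "left_module A N" and fg: "fin_gen A M" "fin_gen A N"
    using assms(3,4) by (auto simp: mod_cat_def)
  interpret M: left_module A M by fact
  interpret N: left_module A N by fact
  let ?D = "direct_sum N M"
  have D: "left_module A ?D" by (rule left_module_direct_sum[OF lm(2,1)])
  have Dm: "?D \<in> mod_cat A"
    using D fin_gen_direct_sum[OF lm(2) fg(2) lm(1) fg(1)] by (simp add: mod_cat_def)
  obtain E :: "('a, 'm) module" and h where E: "E \<in> mod_cat A" and h: "h \<in> Iso A ?D E"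
    using fin_gen_module_in_universe[OF A Dm] .
  have Elm: "left_module A E" using E by (simp add: mod_cat_def)
  interpret E: left_module A E by fact
  let ?r = "restrict (inv_into (carrier ?D) h) (carrier E)"
  have r: "?r \<in> Hom A E ?D" using Iso_inverse[OF h D Elm] by (simp add: Iso_def)
  have hH: "h \<in> Hom A ?D E" and bij: "bij_betw h (carrier ?D) (carrier E)"
    using h by (auto simp: Iso_def)
  have rh: "?r (h z) = z" if "z \<in> carrier ?D" for z
    using bij that HomD(1)[OF hH that] by (simp add: bij_betw_def)
  note dH = direct_sum_Hom[OF lm(2,1)]
  define i where "i = compose (carrier N) h (\<lambda>x\<in>carrier N. (x, \<zero>\<^bsub>M\<^esub>))"
  define s where "s = compose (carrier M) h (\<lambda>y\<in>carrier M. (\<zero>\<^bsub>N\<^esub>, y))"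
  define p where "p = compose (carrier E) (\<lambda>z\<in>carrier ?D. snd z) ?r"
  have iH: "i \<in> Hom A N E" unfolding i_def by (rule Hom_compose[OF dH(1) hH lm(2)])
  have sH: "s \<in> Hom A M E" unfolding s_def by (rule Hom_compose[OF dH(2) hH lm(1)])
  have pH: "p \<in> Hom A E M" unfolding p_def by (rule Hom_compose[OF r dH(3) Elm])
  have ph: "p (h (x, y)) = y" if "x \<in> carrier N" "y \<in> carrier M" for x y
    using rh[of "(x, y)"] HomD(1)[OF hH, of "(x, y)"] that by (simp add: p_def compose_def)
  have i: "i x = h (x, \<zero>\<^bsub>M\<^esub>)" if "x \<in> carrier N" for x using that by (simp add: i_def compose_def)
  have ps: "p (s y) = y" if "y \<in> carrier M" for y using that ph by (simp add: s_def compose_def)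
  have "inj_on i (carrier N)"
    using bij M.M.zero_closed unfolding bij_betw_def inj_on_def by (force simp: i)
  moreover have "i ` carrier N = {x \<in> carrier E. p x = \<zero>\<^bsub>M\<^esub>}"
  proof
    show "i ` carrier N \<subseteq> {x \<in> carrier E. p x = \<zero>\<^bsub>M\<^esub>}"
      using HomD(1)[OF iH] ph i by auto
    show "{x \<in> carrier E. p x = \<zero>\<^bsub>M\<^esub>} \<subseteq> i ` carrier N"
    proof clarify
      fix e assume e: "e \<in> carrier E" "p e = \<zero>\<^bsub>M\<^esub>"
      have "e \<in> h ` carrier ?D" using bij e(1) unfolding bij_betw_def by simp
      then obtain x y where xy: "x \<in> carrier N" "y \<in> carrier M" "e = h (x, y)" by auto
      then have "e = i x" using ph e(2) i by simp
      then show "e \<in> i ` carrier N" using xy(1) by blast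
    qed
  qed
  moreover have "p ` carrier E = carrier M"
  proof
    show "p ` carrier E \<subseteq> carrier M" using HomD(1)[OF pH] by blast
    show "carrier M \<subseteq> p ` carrier E"
    proof
      fix y assume y: "y \<in> carrier M"
      show "y \<in> p ` carrier E" by (rule image_eqI[of _ _ "s y"]) (use ps HomD(1)[OF sH] y in auto)
    qed
  qed
  ultimately have "(E, i, p) \<in> extensions A M N" using E iH pH by (simp add: extensions_def)
  then have "(E, i, p) \<in> Ext1_zero A M N" using sH ps by (auto simp: Ext1_zero_def)
  then show ?thesis by blast
qed

text \<open>The split extensions lie in one class by \<open>split_extensions_equiv\<close>;
  \<open>split\<close> leaves no other extensions, and \<open>ne\<close> ensures that this class
  occurs.\<close>

lemma Ext1_trivialI:
  assumes lm: "left_module A M" "left_module A N"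
    and ne: "Ext1_zero A M N \<noteq> {}"
    and split: "\<And>X. X \<in> extensions A M N \<Longrightarrow> X \<in> Ext1_zero A M N"
  shows "Ext1 A M N = {Ext1_zero A M N}"
proof -
  have sub: "Ext1_zero A M N \<subseteq> extensions A M N" by (auto simp: Ext1_zero_def)
  then have eq: "extensions A M N = Ext1_zero A M N" using split by blast
  have cls: "extension_equiv A M N `` {X} = Ext1_zero A M N" if X: "X \<in> Ext1_zero A M N" for X
  proof
    show "extension_equiv A M N `` {X} \<subseteq> Ext1_zero A M N"
      using split by (auto simp: extension_equiv_def)
    show "Ext1_zero A M N \<subseteq> extension_equiv A M N `` {X}"
      using split_extensions_equiv[OF lm X] by blast
  qed
  show ?thesis
    unfolding Ext1_def quotient_def eq using cls ne by auto
qed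

section \<open>Isomorphism invariance\<close>

text \<open>A submodule of \<open>S'\<close> is the image of its preimage in \<open>S\<close>, and
  that preimage is zero or everything.\<close>

lemma simple_module_Iso:
  assumes S: "simple_module A S" and S': "left_module A S'" and f: "f \<in> Iso A S S'"
  shows "simple_module A S'"
proof -
  note lm = simple_moduleD(1)[OF S]
  interpret S: left_module A S by fact
  have fH: "f \<in> Hom A S S'" and bij: "bij_betw f (carrier S) (carrier S')"
    using f by (auto simp: Iso_def)
  have f0: "f \<zero>\<^bsub>S\<^esub> = \<zero>\<^bsub>S'\<^esub>" by (rule Hom_zero[OF lm S' fH])
  obtain x where x: "x \<in> carrier S" "x \<noteq> \<zero>\<^bsub>S\<^esub>"
    using simple_moduleD(2)[OF S] S.M.zero_closed by blast
  have "f x \<noteq> \<zero>\<^bsub>S'\<^esub>" using x f0 bij S.M.zero_closed by (metis bij_betw_def inj_onD)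
  then have "carrier S' \<noteq> {\<zero>\<^bsub>S'\<^esub>}" using HomD(1)[OF fH x(1)] by blast
  moreover have "H = {\<zero>\<^bsub>S'\<^esub>} \<or> H = carrier S'" if H: "submodule H A S'" for H
  proof -
    have "H \<subseteq> f ` carrier S" using bij submoduleD(1)[OF H] by (auto simp: bij_betw_def)
    then have im: "f ` {x \<in> carrier S. f x \<in> H} = H" by blast
    have "{x \<in> carrier S. f x \<in> H} = {\<zero>\<^bsub>S\<^esub>} \<or> {x \<in> carrier S. f x \<in> H} = carrier S"
      by (rule simple_moduleD(3)[OF S vimage_submodule[OF lm S' fH H]])
    then show ?thesis
    proof
      assume "{x \<in> carrier S. f x \<in> H} = {\<zero>\<^bsub>S\<^esub>}"
      then have "H = f ` {\<zero>\<^bsub>S\<^esub>}" using im by simp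
      then show ?thesis using f0 by simp
    next
      assume "{x \<in> carrier S. f x \<in> H} = carrier S"
      then have "H = f ` carrier S" using im by simp
      then show ?thesis using bij by (simp add: bij_betw_def)
    qed
  qed
  ultimately show ?thesis using S' by (simp add: simple_module_def)
qed

text \<open>Any \<open>u\<close> from \<open>M'\<close> to \<open>N'\<close> is conjugated by the
  isomorphisms into a map from \<open>M\<close> to \<open>N\<close>, which vanishes; undoing the
  bijections shows \<open>u = 0\<close>.\<close>

lemma Hom_trivial_Iso:
  assumes lm: "left_module A M" "left_module A N" "left_module A M'" "left_module A N'"
    and f: "f \<in> Iso A M M'" and g: "g \<in> Iso A N N'"
    and Hom0: "Hom A M N = {zero_hom M N}"
  shows "Hom A M' N' = {zero_hom M' N'}"
proof -
  let ?g = "restrict (inv_into (carrier N) g) (carrier N')"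
  have gi: "?g \<in> Hom A N' N" using Iso_inverse[OF g lm(2,4)] by (simp add: Iso_def)
  have fH: "f \<in> Hom A M M'" and fb: "bij_betw f (carrier M) (carrier M')"
    and gH: "g \<in> Hom A N N'" and gb: "bij_betw g (carrier N) (carrier N')"
    using f g by (auto simp: Iso_def)
  have "u = zero_hom M' N'" if u: "u \<in> Hom A M' N'" for u
  proof (rule Hom_ext[OF u zero_hom_Hom[OF lm(3,4)]])
    fix x assume x: "x \<in> carrier M'"
    then have "x \<in> f ` carrier M" using fb by (simp add: bij_betw_def)
    then obtain y where y: "y \<in> carrier M" "x = f y" by blast
    have "compose (carrier M) (compose (carrier M') ?g u) f \<in> Hom A M N"
      by (intro Hom_compose[OF fH] Hom_compose[OF u gi] lm)
    then have "compose (carrier M) (compose (carrier M') ?g u) f = zero_hom M N" using Hom0 by blast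
    from fun_cong[OF this, of y] have "inv_into (carrier N) g (u x) = \<zero>\<^bsub>N\<^esub>"
      using x y HomD(1)[OF u x] by (simp add: compose_def zero_hom_def)
    moreover have "u x \<in> g ` carrier N" using HomD(1)[OF u x] gb by (simp add: bij_betw_def)
    ultimately have "u x = g \<zero>\<^bsub>N\<^esub>" using f_inv_into_f[of "u x" g "carrier N"] by simp
    then show "u x = zero_hom M' N' x"
      using x Hom_zero[OF lm(2,4) gH] by (simp add: zero_hom_def)
  qed
  then show ?thesis using zero_hom_Hom[OF lm(3,4)] by blast
qed

lemma Iso_refl:
  assumes "left_module A M"
  shows "(\<lambda>x\<in>carrier M. x) \<in> Iso A M M"
proof -
  interpret left_module A M by fact
  show ?thesis
    by (auto simp: Iso_def Hom_def lsmult_closed bij_betw_def inj_on_def)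
qed

section \<open>Torsion pairs and their closure under isomorphism\<close>

lemma torsion_pair_iff:
  assumes "torsion_pair A T F"
  shows "M \<in> T \<longleftrightarrow> M \<in> mod_cat A \<and> (\<forall>N\<in>F. Hom A M N = {zero_hom M N})"
    and "N \<in> F \<longleftrightarrow> N \<in> mod_cat A \<and> (\<forall>M\<in>T. Hom A M N = {zero_hom M N})"
proof -
  have T: "T = {M \<in> mod_cat A. \<forall>N\<in>F. Hom A M N = {zero_hom M N}}"
    using assms unfolding torsion_pair_def by (rule conjunct1)
  have F: "F = {N \<in> mod_cat A. \<forall>M\<in>T. Hom A M N = {zero_hom M N}}"
    using assms unfolding torsion_pair_def by (rule conjunct2)
  show "M \<in> T \<longleftrightarrow> M \<in> mod_cat A \<and> (\<forall>N\<in>F. Hom A M N = {zero_hom M N})"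
    by (subst T) simp
  show "N \<in> F \<longleftrightarrow> N \<in> mod_cat A \<and> (\<forall>M\<in>T. Hom A M N = {zero_hom M N})"
    by (subst F) simp
qed

lemma torsion_pair_mod_cat:
  assumes "torsion_pair A T F"
  shows "T \<subseteq> mod_cat A" "F \<subseteq> mod_cat A"
  by (rule subsetI, simp add: torsion_pair_iff(1)[OF assms],
      rule subsetI, simp add: torsion_pair_iff(2)[OF assms])

lemma torsion_pair_Hom:
  assumes "torsion_pair A T F" "M \<in> T" "N \<in> F"
  shows "Hom A M N = {zero_hom M N}"
  using assms(2,3) by (simp add: torsion_pair_iff(1)[OF assms(1)])

text \<open>\<open>T\<close> and \<open>F\<close> are each cut out by the vanishing of
  \<open>Hom\<close> against the other, and this vanishing is invariant under isomorphism.\<close>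

lemma torsion_pair_iso_class:
  assumes TF: "torsion_pair A T F"
  shows "\<lbrakk>M \<in> T; M' \<in> iso_class A M\<rbrakk> \<Longrightarrow> M' \<in> T"
    and "\<lbrakk>N \<in> F; N' \<in> iso_class A N\<rbrakk> \<Longrightarrow> N' \<in> F"
proof -
  note sub = torsion_pair_mod_cat[OF TF]
  {
    assume M: "M \<in> T" and "M' \<in> iso_class A M"
    then obtain f where M': "M' \<in> mod_cat A" and f: "f \<in> Iso A M M'" by (auto simp: iso_class_def)
    have "Hom A M' N = {zero_hom M' N}" if N: "N \<in> F" for N
    proof -
      have lm: "left_module A M" "left_module A N" "left_module A M'"
        using M N M' sub by (auto simp: mod_cat_def)
      show ?thesis
        by (rule Hom_trivial_Iso[OF lm lm(2) f Iso_refl[OF lm(2)] torsion_pair_Hom[OF TF M N]])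
    qed
    then show "M' \<in> T" using M' by (simp add: torsion_pair_iff(1)[OF TF])
  next
    assume N: "N \<in> F" and "N' \<in> iso_class A N"
    then obtain f where N': "N' \<in> mod_cat A" and f: "f \<in> Iso A N N'" by (auto simp: iso_class_def)
    have "Hom A M N' = {zero_hom M N'}" if M: "M \<in> T" for M
    proof -
      have lm: "left_module A M" "left_module A N" "left_module A N'"
        using M N N' sub by (auto simp: mod_cat_def)
      show ?thesis
        by (rule Hom_trivial_Iso[OF lm(1,2,1,3) Iso_refl[OF lm(1)] f torsion_pair_Hom[OF TF M N]])
    qed
    then show "N' \<in> F" using N' by (simp add: torsion_pair_iff(2)[OF TF])
  }
qed

section \<open>Brick-splitting torsion pairs\<close>

lemma brick_splitting_extension_splits:
  assumes A: "k_algebra k A" and bs: "brick_splitting k A T F"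
    and S1: "S1 \<in> T" "simple_module A S1" and S2: "S2 \<in> F" "simple_module A S2"
    and X: "X \<in> extensions A S2 S1"
  shows "X \<in> Ext1_zero A S2 S1"
proof (rule ccontr)
  assume nonsplit: "X \<notin> Ext1_zero A S2 S1"
  have TF: "torsion_pair A T F" using bs by (simp add: brick_splitting_def)
  note Hom0 = torsion_pair_Hom[OF TF]
  obtain E i p where E: "X = (E, i, p)" by (metis prod_cases3)
  interpret module_extension A S2 S1 E i p
    by (rule module_extension.intro[OF simple_moduleD(1)[OF S2(2)] simple_moduleD(1)[OF S1(2)] X[unfolded E]])
  have "brick k A E"
    \<comment> \<open>The torsion pair supplies \<open>Hom(S1, S2) = 0\<close>, the condition under
      which every non-zero endomorphism of \<open>E\<close> is bijective.\<close>
    using nonsplit[unfolded E]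
    by (intro brickI[OF A E_mod_cat] nontrivial[OF S2(2)]
        nonsplit_endomorphism_bij[OF S2(2) S1(2) Hom0[OF S1(1) S2(1)]]) auto
  then consider "E \<in> T" | "E \<in> F" using bs by (auto simp: brick_splitting_def)
  then show False
  proof cases
    case 1
    then have "p = zero_hom E S2" using Hom0[OF 1 S2(1)] p_Hom by blast
    then have "carrier S2 \<subseteq> {\<zero>\<^bsub>S2\<^esub>}" using p_surj by (auto simp: zero_hom_def)
    then show False using simple_moduleD(2)[OF S2(2)] M.M.zero_closed by blast
  next
    case 2
    then have "i = zero_hom S1 E" using Hom0[OF S1(1) 2] i_Hom by blast
    then have "x = \<zero>\<^bsub>S1\<^esub>" if "x \<in> carrier S1" for x
      using inj_onD[OF inj_i, of x "\<zero>\<^bsub>S1\<^esub>"] that by (simp add: zero_hom_def)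
    then show False using simple_moduleD(2)[OF S1(2)] N.M.zero_closed by blast
  qed
qed

theorem proposition1p2:
  fixes k :: "'k ring" and A :: "('k, 'a) module"
    and \<iota> :: "'k list \<Rightarrow> 'm"
    and T F :: "('a, 'm) module set"
  assumes "fin_dim_algebra k A"
    and "connected_algebra k A"
    and universe: "inj_on \<iota> (lists (carrier k))"
    and "torsion_pair A T F"
    and "brick_splitting k A T F"
  shows "(\<forall>S\<^sub>1\<in>T. \<forall>S\<^sub>2\<in>F. simple_module A S\<^sub>1 \<and> simple_module A S\<^sub>2 \<longrightarrow>
             Ext1 A S\<^sub>2 S\<^sub>1 = {Ext1_zero A S\<^sub>2 S\<^sub>1}) \<and>
         (\<forall>S\<^sub>1\<in>T. \<forall>S\<^sub>2\<in>F. simple_module A S\<^sub>1 \<and> simple_module A S\<^sub>2 \<longrightarrow>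
             \<not> dominates (ext_quiver A) (iso_class A S\<^sub>2) (iso_class A S\<^sub>1))"
proof -
  have A: "k_algebra k A" using assms(1) unfolding fin_dim_algebra_def by (rule conjunct1)
  note sub = torsion_pair_mod_cat[OF assms(4)]
  have Ext: "Ext1 A S2 S1 = {Ext1_zero A S2 S1}"
    if S: "S1 \<in> T" "S2 \<in> F" "simple_module A S1" "simple_module A S2" for S1 S2
  proof (rule Ext1_trivialI)
    show "left_module A S2" "left_module A S1"
      by (rule simple_moduleD(1)[OF S(4)], rule simple_moduleD(1)[OF S(3)])
    have "S2 \<in> mod_cat A" "S1 \<in> mod_cat A" using S(1,2) sub by blast+
    then show "Ext1_zero A S2 S1 \<noteq> {}" by (rule Ext1_zero_nonempty[OF assms(1) universe])
    show "X \<in> Ext1_zero A S2 S1" if "X \<in> extensions A S2 S1" for X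
      by (rule brick_splitting_extension_splits[OF A assms(5) S(1,3,2,4) that])
  qed
  have "\<not> dominates (ext_quiver A) (iso_class A S2) (iso_class A S1)"
    if S: "S1 \<in> T" "S2 \<in> F" "simple_module A S1" "simple_module A S2" for S1 S2
  proof
    assume "dominates (ext_quiver A) (iso_class A S2) (iso_class A S1)"
    \<comment> \<open>The arrow yields only some representatives of the two vertices; they are again
      simple and in \<open>F\<close> and \<open>T\<close>, so the vanishing already proved applies
      to them.\<close>
    then obtain S S' where SS: "S \<in> iso_class A S2" "S' \<in> iso_class A S1"
      and ne: "Ext1 A S S' \<noteq> {Ext1_zero A S S'}"
      unfolding arcs_ends_def arc_to_ends_def ext_quiver_def Let_def by auto
    have "S \<in> F" "S' \<in> T" using torsion_pair_iso_class[OF assms(4)] S SS by blast+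
    moreover have "simple_module A S" "simple_module A S'"
      using simple_module_Iso S SS by (auto simp: iso_class_def mod_cat_def)
    ultimately show False using Ext ne by blast
  qed
  then show ?thesis using Ext by blast
qed

end
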